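(* Let $(\mathcal N,\mathcal O,\mathfrak l)$ be a plabic network containing the square configuration described in the context, with square edges $h_1,\dots,h_4$ of weights $\alpha_1,\dots,\alpha_4$ carrying the edge vectors $F_1,\dots,F_4$, and let $\tilde F_1,\dots,\tilde F_4$ be the edge vectors at the corresponding edges after the square move, with $\tilde\alpha_1,\dots,\tilde\alpha_4$ the new weights. Then $$\tilde F_4=\tilde\alpha_4\alpha_3^{-1}(-1)^{\mathrm{int}(h_3)+\mathrm{int}(h_4)+\gamma_2(h_4)+\mathrm{wind}(h_3,h_4)+1}F_3+\tilde\alpha_4(-1)^{\mathrm{int}(h_4)+\gamma_2(h_4)}F_4,$$ $$\tilde F_2=\alpha_1(-1)^{\mathrm{int}(h_1)+\gamma_2(h_4)+\mathrm{wind}(h_2,-h_4)+\mathrm{wind}(h_3,h_4)+1}F_3+\alpha_2\alpha_4^{-1}(-1)^{1+\mathrm{int}(h_2)+\mathrm{int}(h_4)+\gamma_2(h_4)+\mathrm{wind}(h_2,-h_4)}F_4,$$ $$\tilde F_1=\tilde\alpha_1(-1)^{\mathrm{int}(h_1)+\mathrm{wind}(-h_1,h_2)}\tilde F_2,$$ $$\tilde F_3=(-1)^{\mathrm{int}(h_3)+\mathrm{int}(h_4)+\gamma_2(h_4)+\mathrm{wind}(h_3,h_4)+1}\,\alpha_2\alpha_1^{-1}\,\tilde F_4 .$$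
   Context: **Plabic networks.** Let $D$ be a closed convex disk whose boundary contains a straight segment. A plabic graph is a finite directed planar graph embedded in $D$ with straight edges. It has boundary vertices $b_1,\dots,b_n$ on the segment, labelled clockwise, each of degree 1 (a source if its edge is outgoing, a sink otherwise). The remaining (internal) vertices lie inside $D$ and have degree 2 or 3. No component is isolated from the boundary. The graph is perfect: each internal vertex has exactly one incoming edge (then it is white) or exactly one outgoing edge (then it is black); bivalent vertices have one incoming and one outgoing edge and either color. The orientation $\mathcal O$ is called a perfect orientation. A network $\mathcal N$ has a positive weight $w_e$ on each directed edge. **Gauge rays.** A gauge ray direction $\mathfrak l$ is an oriented direction, not parallel to any edge, such that the rays with direction $\mathfrak l$ starting at boundary vertices point inside $D$ and contain no internal vertices. The gauge rays are those starting at the boundary sources, and $\mathrm{int}(e)$ is the number of their intersections with $e$ (base points not counted). **Winding.** $s(a,b)=+1,0,-1$ if the ordered pair $(a,b)$ is positively oriented, parallel, negatively oriented. For consecutive directed edges: $\mathrm{wind}(e,f)=\pm1$ if $s(e,f)=s(e,\mathfrak l)=s(\mathfrak l,f)=\pm1$; otherwise $0$. $\gamma_2(e)=\frac{1-s(e,\mathfrak l)}2$. $-h$ denotes the edge $h$ with reversed direction. **Edge vectors.** The edge vectors are the unique solution of $E_e=(-1)^{\mathrm{int}(e)}w_e\sum_f(-1)^{\mathrm{wind}(e,f)}E_f$ (for every edge $e$ ending at an internal vertex $V$, $f$ running over the edges outgoing at $V$), with $E_{e_j}=(-1)^{\mathrm{int}(e_j)}w_{e_j}E_j$ at the edge $e_j$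 ending at the sink $b_j$, $E_j$ being the $j$-th canonical basis vector of $\mathbb R^n$. **Square configuration.** Four trivalent vertices $S,P,Q,R$ bound a quadrilateral face and appear in this order clockwise around it; $S,Q$ are white and $P,R$ black. Directed square edges: $h_1=(S,P)$, $h_2=(S,R)$, $h_3=(P,Q)$, $h_4=(Q,R)$, with weights $\alpha_1,\alpha_2,\alpha_3,\alpha_4$. The remaining edges at $S,P,R,Q$ (outside the square) are $e_1$ incoming at $S$, $e_2$ incoming at $P$, $e_3$ outgoing at $R$, $e_4$ outgoing at $Q$. In particular the directions $h_4,e_4,-h_3$ at $Q$ and $-h_2,e_3,-h_4$ at $R$ are each in counterclockwise cyclic order. **Square move.** The colors of the four vertices are switched, vertices keep their positions, the edges $h_1$ and $h_4$ are reversed (becoming $-h_1=(P,S)$ and $-h_4=(R,Q)$), all other orientations and all weights outside the square are unchanged, and the new weights of $-h_1,h_2,h_3,-h_4$ are $$\tilde\alpha_1=\frac{\alpha_3\alpha_4}{\tilde\alpha_2},\quad\tilde\alpha_2=\alpha_2+\alpha_1\alpha_3\alpha_4,\quad\tilde\alpha_3=\frac{\alpha_2\alpha_3}{\tilde\alpha_2},\quad\tilde\alpha_4=\frac{\alpha_1\alpha_3}{\tilde\alpha_2}.$$ $F_i$ is the edge vector at $h_i$ before the move; $\tilde F_1,\tilde F_2,\tilde F_3,\tilde F_4$ are the edge vectors at $-h_1,h_2,h_3,-h_4$ after the move. *)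

theory Defs
  imports "HOL-Complex_Analysis.Complex_Analysis"
begin

text \<open>The plane is \<^typ>\<open>complex\<close>. All edges are straight, so there are no loops and no two edges
  between the same vertices; a directed edge is the pair (start, end) of its end points, and the
  reversed edge is \<^const>\<open>prod.swap\<close>.\<close>

type_synonym edge = "complex \<times> complex"

datatype colour = White | Black

text \<open>The type \<open>'n\<close> (finite and linearly ordered) plays the role of the labels \<open>1, \<dots>, n\<close> of the
  boundary vertices. The colours of boundary vertices are irrelevant.\<close>

record 'n network =
  disk :: "complex set"
  verts :: "complex set"
  edges :: "edge set"
  bdry :: "'n \<Rightarrow> complex"
  colour :: "complex \<Rightarrow> colour"
  weight :: "edge \<Rightarrow> real"

definition cross :: "complex \<Rightarrow> complex \<Rightarrow> real" where
  "cross a b = Re a * Im b - Im a * Re b"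

definition dir :: "edge \<Rightarrow> complex" where
  "dir e = snd e - fst e"

definition seg :: "edge \<Rightarrow> complex set" where
  "seg e = closed_segment (fst e) (snd e)"

definition drawing :: "'n network \<Rightarrow> complex set" where
  "drawing N = verts N \<union> (\<Union>e\<in>edges N. seg e)"

definition internal :: "'n network \<Rightarrow> complex set" where
  "internal N = verts N - range (bdry N)"

definition in_edges :: "'n network \<Rightarrow> complex \<Rightarrow> edge set" where
  "in_edges N v = {e \<in> edges N. snd e = v}"

definition out_edges :: "'n network \<Rightarrow> complex \<Rightarrow> edge set" where
  "out_edges N v = {e \<in> edges N. fst e = v}"

definition deg :: "'n network \<Rightarrow> complex \<Rightarrow> nat" where
  "deg N v = card (in_edges N v) + card (out_edges N v)"

definition faces :: "'n network \<Rightarrow> complex set set" where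
  "faces N = components (disk N - drawing N)"


section \<open>Plabic networks\<close>

definition closed_convex_disk :: "complex set \<Rightarrow> bool" where
  "closed_convex_disk D \<longleftrightarrow> compact D \<and> convex D \<and> interior D \<noteq> {}"

definition planar_straight_graph :: "'n network \<Rightarrow> bool" where
  "planar_straight_graph N \<longleftrightarrow>
     finite (verts N) \<and> edges N \<subseteq> verts N \<times> verts N \<and> (\<forall>e\<in>edges N. fst e \<noteq> snd e) \<and>
     (\<forall>e\<in>edges N. verts N \<inter> seg e = {fst e, snd e}) \<and>
     (\<forall>e\<in>edges N. \<forall>e'\<in>edges N. e \<noteq> e' \<longrightarrow>
        seg e \<inter> seg e' \<subseteq> {fst e, snd e} \<inter> {fst e', snd e'})"

definition vertices_in_disk :: "'n network \<Rightarrow> bool" where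
  "vertices_in_disk N \<longleftrightarrow>
     range (bdry N) \<subseteq> verts N \<and> internal N \<subseteq> interior (disk N) \<and>
     (\<exists>p q. p \<noteq> q \<and> closed_segment p q \<subseteq> frontier (disk N) \<and> range (bdry N) \<subseteq> closed_segment p q)"

text \<open>Seen from any interior point \<open>z\<close> of the disk, the boundary vertices (all on one segment) turn
  in the negative direction as the label increases. In particular they are distinct.\<close>

definition clockwise_labelling :: "'n::linorder network \<Rightarrow> bool" where
  "clockwise_labelling N \<longleftrightarrow>
     (\<forall>i j. i < j \<longrightarrow> (\<forall>z\<in>interior (disk N). cross (bdry N i - z) (bdry N j - z) < 0))"

definition perfect :: "'n network \<Rightarrow> bool" where
  "perfect N \<longleftrightarrow>
     (\<forall>v\<in>internal N. case colour N v of
        White \<Rightarrow> card (in_edges N v) = 1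
      | Black \<Rightarrow> card (out_edges N v) = 1)"

definition plabic_network :: "'n::{finite,linorder} network \<Rightarrow> bool" where
  "plabic_network N \<longleftrightarrow>
     closed_convex_disk (disk N) \<and> planar_straight_graph N \<and>
     vertices_in_disk N \<and> clockwise_labelling N \<and>
     (\<forall>j. deg N (bdry N j) = 1) \<and>
     (\<forall>v\<in>internal N. deg N v = 2 \<or> deg N v = 3) \<and>
     (\<forall>v\<in>verts N. \<exists>j. (v, bdry N j) \<in> (edges N \<union> (edges N)\<inverse>)\<^sup>*) \<and>
     perfect N \<and>
     (\<forall>e\<in>edges N. weight N e > 0)"


section \<open>Gauge rays, intersection numbers and winding\<close>

text \<open>Rays are taken without their base point.\<close>

definition gauge_ray :: "'n network \<Rightarrow> complex \<Rightarrow> 'n \<Rightarrow> complex set" where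
  "gauge_ray N l j = {bdry N j + t *\<^sub>R l | t. t > 0}"

text \<open>As the disk is convex, the ray from \<open>b\<^sub>j\<close> (a point of the frontier) points inside the disk
  iff it contains an interior point of it. This also forces \<open>l \<noteq> 0\<close>.\<close>

definition gauge_direction :: "'n network \<Rightarrow> complex \<Rightarrow> bool" where
  "gauge_direction N l \<longleftrightarrow>
     (\<forall>e\<in>edges N. cross (dir e) l \<noteq> 0) \<and>
     (\<forall>j. gauge_ray N l j \<inter> interior (disk N) \<noteq> {} \<and> gauge_ray N l j \<inter> internal N = {})"

definition is_source :: "'n network \<Rightarrow> 'n \<Rightarrow> bool" where
  "is_source N j \<longleftrightarrow> out_edges N (bdry N j) \<noteq> {}"

definition int_num :: "'n::finite network \<Rightarrow> complex \<Rightarrow> edge \<Rightarrow> nat" where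
  "int_num N l e = (\<Sum>j | is_source N j. card (gauge_ray N l j \<inter> seg e))"

definition orient :: "complex \<Rightarrow> complex \<Rightarrow> int" where
  "orient a b = (if cross a b > 0 then 1 else if cross a b < 0 then - 1 else 0)"

definition wind :: "complex \<Rightarrow> edge \<Rightarrow> edge \<Rightarrow> int" where
  "wind l e f =
     (if orient (dir e) (dir f) = orient (dir e) l \<and> orient (dir e) l = orient l (dir f)
      then orient (dir e) (dir f) else 0)"

text \<open>The division is exact, since gauge directions are not parallel to edges.\<close>

definition gamma2 :: "complex \<Rightarrow> edge \<Rightarrow> int" where
  "gamma2 l e = (1 - orient (dir e) l) div 2"

definition sg :: "int \<Rightarrow> real" where
  "sg k = (- 1) powi k"


section \<open>Edge vectors\<close>

definition edge_system :: "'n::finite network \<Rightarrow> complex \<Rightarrow> (edge \<Rightarrow> real ^ 'n) \<Rightarrow> bool" where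
  "edge_system N l E \<longleftrightarrow>
     (\<forall>e\<in>edges N. snd e \<in> internal N \<longrightarrow>
        E e = (sg (int (int_num N l e)) * weight N e) *\<^sub>R
                (\<Sum>f\<in>out_edges N (snd e). sg (wind l e f) *\<^sub>R E f)) \<and>
     (\<forall>e\<in>edges N. \<forall>j. snd e = bdry N j \<longrightarrow>
        E e = (sg (int (int_num N l e)) * weight N e) *\<^sub>R axis j 1)"

text \<open>\<open>E\<close> is the unique solution; its values off the edges are irrelevant.\<close>

definition edge_vectors :: "'n::finite network \<Rightarrow> complex \<Rightarrow> (edge \<Rightarrow> real ^ 'n) \<Rightarrow> bool" where
  "edge_vectors N l E \<longleftrightarrow>
     edge_system N l E \<and> (\<forall>E'. edge_system N l E' \<longrightarrow> (\<forall>e\<in>edges N. E' e = E e))"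


section \<open>The square move\<close>

definition quad :: "complex \<Rightarrow> complex \<Rightarrow> complex \<Rightarrow> complex \<Rightarrow> real \<Rightarrow> complex" where
  "quad a b c d = linepath a b +++ linepath b c +++ linepath c d +++ linepath d a"

text \<open>The remaining edges \<open>e\<^sub>1, \<dots>, e\<^sub>4\<close> need not be mentioned: in a perfect network the colours and
  the degrees force exactly one further edge, incoming at \<open>S\<close> and \<open>P\<close> and outgoing at \<open>R\<close> and \<open>Q\<close>;
  it lies outside the quadrilateral because the latter bounds a face.\<close>

definition square_config ::
    "'n network \<Rightarrow> complex \<Rightarrow> complex \<Rightarrow> complex \<Rightarrow> complex \<Rightarrow> bool" where
  "square_config N S P Q R \<longleftrightarrow>
     distinct [S, P, Q, R] \<and> {S, P, Q, R} \<subseteq> internal N \<and>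
     (\<forall>v\<in>{S, P, Q, R}. deg N v = 3) \<and>
     colour N S = White \<and> colour N Q = White \<and> colour N P = Black \<and> colour N R = Black \<and>
     {(S, P), (S, R), (P, Q), (Q, R)} \<subseteq> edges N \<and>
     inside (path_image (quad S P Q R)) \<in> faces N \<and>
     (\<forall>z\<in>inside (path_image (quad S P Q R)). winding_number (quad S P Q R) z = - 1)"

fun switch :: "colour \<Rightarrow> colour" where
  "switch White = Black"
| "switch Black = White"

definition square_move ::
    "'n network \<Rightarrow> complex \<Rightarrow> complex \<Rightarrow> complex \<Rightarrow> complex \<Rightarrow> 'n network" where
  "square_move N S P Q R =
     (let a1 = weight N (S, P); a2 = weight N (S, R); a3 = weight N (P, Q); a4 = weight N (Q, R);
          a2' = a2 + a1 * a3 * a4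
      in N\<lparr>edges := edges N - {(S, P), (Q, R)} \<union> {(P, S), (R, Q)},
           colour := (\<lambda>v. if v \<in> {S, P, Q, R} then switch (colour N v) else colour N v),
           weight := (weight N)((P, S) := a3 * a4 / a2', (S, R) := a2',
                                (P, Q) := a2 * a3 / a2', (R, Q) := a1 * a3 / a2')\<rparr>)"

end

theory Submission
  imports Defs
begin

text \<open>
  Modifying the edge vectors of the original network on the four square edges by the stated formulas
  gives a solution of the linear system of the new network, so uniqueness identifies it with the new
  edge vectors. The equations to be checked differ from ring identities in the weights only by signs,
  and these come from geometry. Each gauge ray meets the inside of the disk in the same points as
  its full line, so it crosses the closed square an even number of times and
  \<open>int h\<^sub>1 + int h\<^sub>2 + int h\<^sub>3 + int h\<^sub>4\<close> is even. The extra edge at each vertex of the square lies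
  outside the face, which fixes the cyclic order of the three edges there and with it the parity
  of a sum of windings. Finally the total turning of a simple clockwise quadrilateral is one full
  turn, so its four windings add up to an odd number.
\<close>

section \<open>Signs of windings\<close>

text \<open>Edges outside the square keep their vectors. Besides the equations at the four square
  edges, only those at edges entering \<open>S\<close> and \<open>P\<close> could fail: what such an
  edge receives from the square must be the same before and after the move, and this is what calls
  for the sign relations. The obstacle is that the square need not be convex. A corner may be reflex
  or straight, so no single corner has a known orientation; the square is therefore cut along
  whichever diagonal works. Identities between windings become finite case analyses on the signs of
  cross products, where the Pluecker relation excludes the patterns that no vectors in the plane
  realise. Signs are kept as real factors 1 and -1, so that they multiply directly with the
  weights.\<close>

lemma cross_minus [simp]: "cross (- a) b = - cross a b" "cross a (- b) = - cross a b"
  by (simp_all add: cross_def)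

lemma cross_commute: "cross a b = - cross b a"
  by (simp add: cross_def)

text \<open>Turning from \<open>a\<close> to \<open>b\<close> through the smaller angle passes \<open>l\<close> (and not \<open>- l\<close>), that is, \<^const>\<open>wind\<close> is odd.\<close>

definition passes :: "complex \<Rightarrow> complex \<Rightarrow> complex \<Rightarrow> bool" where
  "passes l a b \<longleftrightarrow> cross a l > 0 \<and> cross b l < 0 \<and> cross a b > 0 \<or>
                   cross a l < 0 \<and> cross b l > 0 \<and> cross a b < 0"

text \<open>For directions not parallel to \<open>l\<close>, \<open>wsign\<close> and
  \<open>gsign\<close> are \<open>sg\<close> of \<open>wind\<close> and of \<open>gamma2\<close>;
  see \<open>sg_wind\<close> and \<open>sg_gamma2\<close>.\<close>

definition wsign :: "complex \<Rightarrow> complex \<Rightarrow> complex \<Rightarrow> real" where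
  "wsign l a b = (if passes l a b then - 1 else 1)"

definition gsign :: "complex \<Rightarrow> complex \<Rightarrow> real" where
  "gsign l a = (if cross a l < 0 then - 1 else 1)"

text \<open>The rays spanned by \<open>a\<close>, \<open>b\<close>, \<open>c\<close> are in counterclockwise cyclic order: of the three
  counterclockwise angles between neighbours, which add up to a full turn, at most one can be
  \<open>\<pi>\<close> or more.\<close>

definition ccw :: "complex \<Rightarrow> complex \<Rightarrow> complex \<Rightarrow> bool" where
  "ccw a b c \<longleftrightarrow>
     cross a b > 0 \<and> cross b c > 0 \<or> cross b c > 0 \<and> cross c a > 0 \<or> cross c a > 0 \<and> cross a b > 0"

lemma cross_pluecker: "cross a b * cross c l + cross b c * cross a l + cross c a * cross b l = 0"
  by (simp add: cross_def algebra_simps)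

text \<open>Here \<open>- a\<close> and \<open>- c\<close> arrive at a vertex and \<open>b\<close>
  leaves it. Moving \<open>b\<close> inside its sector changes both factors on the left or neither,
  so their product depends on \<open>a\<close> and \<open>c\<close> only.\<close>

lemma wsign_out:
  assumes "ccw a b c" "cross a l \<noteq> 0" "cross b l \<noteq> 0" "cross c l \<noteq> 0"
  shows "wsign l (- a) b * wsign l (- c) b = - gsign l a * wsign l (- c) a"
proof -
  define x y z p q r where d: "x = cross a b" "y = cross b c" "z = cross c a" "p = cross a l"
    "q = cross b l" "r = cross c l"
  \<comment> \<open>Each product is an unknown tied to its factors by the sign rules alone; this
    relation excludes the remaining impossible sign patterns.\<close>
  have "x * r + y * p + z * q = 0" using cross_pluecker d by simp
  then have "(passes l (- a) b = passes l (- c) b) \<longleftrightarrow> (cross a l < 0) = (\<not> passes l (- c) a)"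
    using assms zero_less_mult_iff[of x r] mult_less_0_iff[of x r] zero_less_mult_iff[of y p]
      mult_less_0_iff[of y p]
      zero_less_mult_iff[of z q] mult_less_0_iff[of z q]
    unfolding passes_def ccw_def cross_minus cross_commute[of c b] d[symmetric]
    by argo
  then show ?thesis by (auto simp: wsign_def gsign_def)
qed

text \<open>The counterpart of \<open>wsign_out\<close> for an edge that arrives along the ray
  \<open>b\<close>, hence has direction \<open>- b\<close>, and may continue along \<open>a\<close>
  or \<open>c\<close>.\<close>

lemma wsign_in:
  assumes "ccw a b c" "cross a l \<noteq> 0" "cross b l \<noteq> 0" "cross c l \<noteq> 0"
  shows "wsign l (- b) a * wsign l (- b) c = - gsign l c * wsign l (- c) a"
proof -
  define x y z p q r where d: "x = cross a b" "y = cross b c" "z = cross c a" "p = cross a l"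
    "q = cross b l" "r = cross c l"
  have "x * r + y * p + z * q = 0" using cross_pluecker d by simp
  then have "(passes l (- b) a = passes l (- b) c) \<longleftrightarrow> (cross c l < 0) = (\<not> passes l (- c) a)"
    using assms zero_less_mult_iff[of x r] mult_less_0_iff[of x r] zero_less_mult_iff[of y p]
      mult_less_0_iff[of y p]
      zero_less_mult_iff[of z q] mult_less_0_iff[of z q]
    unfolding passes_def ccw_def cross_minus cross_commute[of b a] d[symmetric]
    by argo
  then show ?thesis by (auto simp: wsign_def gsign_def)
qed

text \<open>The reversed corner sweeps the opposite sector, so it passes \<open>l\<close> when the
  original one passes \<open>- l\<close>. If \<open>u\<close> and \<open>v\<close> lie on different
  sides of the line of \<open>l\<close>, exactly one of \<open>l\<close> and \<open>- l\<close> is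
  passed, otherwise neither. The first assumption excludes opposite directions, for which the
  smaller angle is ambiguous.\<close>

lemma wsign_reverse:
  assumes "cross u v \<noteq> 0 \<or> gsign l u = gsign l v" "cross u l \<noteq> 0" "cross v l \<noteq> 0"
  shows "wsign l u v * wsign l (- v) (- u) = gsign l u * gsign l v"
  using assms unfolding wsign_def passes_def gsign_def cross_minus cross_commute[of v u]
    by (auto split: if_splits)

text \<open>Three clockwise corners already force the closed quadrilateral to be simple, hence to turn once.\<close>

lemma wsign_polygon:
  assumes "a + b + c + d = 0" "cross a b < 0" "cross b c < 0" "cross c d < 0"
     "cross a l \<noteq> 0" "cross b l \<noteq> 0" "cross c l \<noteq> 0" "cross d l \<noteq> 0"
  shows "wsign l a b * wsign l b c * wsign l c d * wsign l d a = - 1"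
proof -
  define p q r s where n: "p = cross a l" "q = cross b l" "r = cross c l" "s = cross d l"
  define x y z w u where m: "x = cross a b" "y = cross b c" "z = cross c d" "w = cross d a" "u = cross a c"
  have d: "d = - a - b - c" using assms(1) by (simp add: algebra_simps eq_neg_iff_add_eq_0)
  define v where "v = cross b d"
  have z: "z = y + u" "w = x + u" "v = x - y" "s = - p - q - r"
    by (auto simp: d m n v_def cross_def algebra_simps)
  \<comment> \<open>One Pluecker relation for each triple of sides. The signs of \<open>w\<close>,
    \<open>u\<close> and \<open>v\<close> stay open, which allows a reflex corner between
    \<open>d\<close> and \<open>a\<close>.\<close>
  have g: "x * r + y * p = u * q" "y * s + z * q = v * r" "z * p + w * r + u * s = 0"
    "x * s + w * q + v * p = 0"
    using cross_pluecker[of a b c l] cross_pluecker[of b c d l] cross_pluecker[of a c d l] cross_pluecker[of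
      a b d l]
    by (simp_all add: m n v_def cross_commute[of c a] cross_commute[of d b])
  note sgn = zero_less_mult_iff mult_less_0_iff
  have "(passes l a b = passes l b c) \<longleftrightarrow> (passes l c d \<noteq> passes l d a)"
    using assms z g sgn[of x r] sgn[of y p] sgn[of u q] sgn[of y s] sgn[of z q] sgn[of v r]
      sgn[of z p] sgn[of w r] sgn[of u s] sgn[of x s] sgn[of w q] sgn[of v p]
    unfolding passes_def n[symmetric] m[symmetric]
    by argo
  then show ?thesis by (auto simp: wsign_def)
qed

section \<open>Clockwise quadrilaterals\<close>

text \<open>Twice the signed area of a triangle, negative when its vertices run clockwise.\<close>

definition area2 :: "complex \<Rightarrow> complex \<Rightarrow> complex \<Rightarrow> real" where
  "area2 a b c = cross (b - a) (c - a)"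

lemma area2_rotate: "area2 b c a = area2 a b c"
  by (simp add: area2_def cross_def algebra_simps)

lemma area2_convex:
  "u + v + w = 1 \<Longrightarrow> area2 a b (u *\<^sub>R p + v *\<^sub>R q + w *\<^sub>R r) = u * area2 a b p + v * area2 a b q +
    w * area2 a b r"
proof -
  assume "u + v + w = 1"
  then have u: "u = 1 - v - w" by simp
  show ?thesis unfolding u by (simp add: area2_def cross_def algebra_simps)
qed

lemma area2_simps [simp]: "area2 a b a = 0" "area2 a b b = 0"  "area2 a a b = 0"
  by (auto simp: area2_def cross_def)

lemma area2_swap: "area2 b a c = - area2 a b c"
  by (simp add: area2_def cross_def algebra_simps)

lemma area2_closed_segment: "z \<in> closed_segment a b \<Longrightarrow> area2 a b z = 0"
proof -
  assume "z \<in> closed_segment a b"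
  then obtain u where "z = (1 - u) *\<^sub>R a + u *\<^sub>R b" unfolding in_segment by blast
  then have "z - a = u *\<^sub>R (b - a)" by (simp add: algebra_simps)
  then show "area2 a b z = 0" by (simp add: area2_def cross_def)
qed

lemma interior_triangle_nonempty:
  assumes "area2 a b c \<noteq> 0"
  shows "interior (convex hull {a, b, c}) \<noteq> {}"
proof -
  have ne: "a \<noteq> b" "b \<noteq> c" "a \<noteq> c" using assms by (auto simp: area2_def cross_def algebra_simps)
  have "\<not> collinear {a, b, c}"
  proof
    assume "collinear {a, b, c}"
    then obtain u where u: "\<forall>x\<in>{a, b, c}. \<forall>y\<in>{a, b, c}. \<exists>k. x - y = k *\<^sub>R u" unfolding collinear_def
      by blast
    then obtain s t where "b - a = s *\<^sub>R u" "c - a = t *\<^sub>R u" by blast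
    then show False using assms by (simp add: area2_def cross_def)
  qed
  then have "\<not> affine_dependent {a, b, c}" by (simp add: collinear_3_eq_affine_dependent)
  moreover have "card {a, b, c} = Suc DIM(complex)" using ne by simp
  ultimately show ?thesis using interior_convex_hull_eq_empty by blast
qed

lemma interior_triangle_area2:
  assumes "z \<in> interior (convex hull {a, b, c})" "area2 a b c \<noteq> 0"
  shows "area2 a b z * area2 a b c > 0"
proof -
  let ?k = "area2 a b c"
  \<comment> \<open>A normal of the line \<open>a b\<close>; the factor \<open>?k\<close> makes it
    point to the side of \<open>c\<close> for either orientation.\<close>
  define d where "d = Complex (- Im (b - a) * ?k) (Re (b - a) * ?k)"
  have ip: "area2 a b x * ?k = inner d x - inner d a" for x
    by (simp add: d_def area2_def cross_def inner_complex_def algebra_simps)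
  have d0: "d \<noteq> 0" using assms(2) ip[of c] by auto
  have "convex hull {a, b, c} \<subseteq> {x. inner d x \<ge> inner d a}"
  proof
    fix x assume "x \<in> convex hull {a, b, c}"
    then obtain u v w where "u \<ge> 0" "v \<ge> 0" "w \<ge> 0" "u + v + w = 1" "x = u *\<^sub>R a + v *\<^sub>R b + w *\<^sub>R c"
      unfolding convex_hull_3 by blast
    then have "area2 a b x * ?k \<ge> 0"
      by (simp add: area2_convex) (metis mult.assoc mult_nonneg_nonneg zero_le_square)
    then show "x \<in> {x. inner d x \<ge> inner d a}" using ip[of x] by simp
  qed
  then have "z \<in> interior {x. inner d x \<ge> inner d a}" using assms(1) interior_mono by blast
  then have "inner d z > inner d a" using d0 by simp
  then show ?thesis using ip[of z] by simp
qed

section \<open>Winding numbers of triangles and quadrilaterals\<close>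

lemma winding_number_triangle_area2:
  assumes "z \<in> interior (convex hull {a, b, c})" "area2 a b c \<noteq> 0"
  shows "winding_number (linepath a b +++ linepath b c +++ linepath c a) z = sgn (area2 a b c)"
proof -
  have "Im ((b - a) * cnj (b - z)) = area2 a b z" by (simp add: area2_def cross_def algebra_simps)
  then show ?thesis using interior_triangle_area2[OF assms] winding_number_triangle[OF assms(1)]
    by (auto simp: zero_less_mult_iff)
qed

lemma quad_path [simp]:
  "path (quad a b c d)" "pathfinish (quad a b c d) = a" "pathstart (quad a b c d) = a"
  "path_image (quad a b c d) =
     closed_segment a b \<union> closed_segment b c \<union> closed_segment c d \<union> closed_segment d a"
  by (auto simp: quad_def path_image_join)

lemma winding_number_quad:
  assumes "z \<notin> path_image (quad a b c d)"
  shows "winding_number (quad a b c d) z = winding_number (linepath a b) z + winding_number (linepath b c) z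
           + winding_number (linepath c d) z + winding_number (linepath d a) z"
  using assms unfolding quad_path by (simp add: quad_def winding_number_join path_image_join)

lemma winding_number_linepath_swap:
  "z \<notin> closed_segment a c \<Longrightarrow> winding_number (linepath c a) z = - winding_number (linepath a c) z"
  using winding_number_reversepath[of "linepath a c" z] by simp

lemma interior_triangle_outside_segment:
  assumes "z \<in> interior (convex hull {a, b, c})" "area2 a b c \<noteq> 0"
  shows "z \<notin> closed_segment a b" "z \<notin> closed_segment b c" "z \<notin> closed_segment c a"
proof -
  have p: "{b,c,a} = {a,b,c}" "{c,a,b} = {a,b,c}" by auto
  show "z \<notin> closed_segment a b" "z \<notin> closed_segment b c" "z \<notin> closed_segment c a"
    using interior_triangle_area2[of z a b c] interior_triangle_area2[of z b c a] interior_triangle_area2[of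
      z c a b]
      assms area2_closed_segment area2_rotate[of a b c] area2_rotate[of b c a] unfolding p by force+
qed

text \<open>The path is the sum of the triangles \<open>a b c\<close> and \<open>a c d\<close>,
  since the diagonal cancels. Equal orientation puts the triangles on different sides of the
  diagonal, so \<open>z\<close> is outside the second one, which contributes 0.\<close>

lemma winding_number_quad_triangle:
  assumes z: "z \<in> interior (convex hull {a, b, c})" and s: "area2 a b c * area2 a c d > 0"
  shows "z \<notin> path_image (quad a b c d)" "winding_number (quad a b c d) z = sgn (area2 a b c)"
proof -
  have nz: "area2 a b c \<noteq> 0" using s by auto
  have p: "{c,a,b} = {a,b,c}" by auto
  have side: "area2 a c z * area2 a c d < 0"
    using interior_triangle_area2[of z c a b] z nz s area2_rotate[of a b c] area2_rotate[of b c a]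
      area2_swap[of a c z]
    unfolding p by (auto simp: zero_less_mult_iff mult_less_0_iff)
  have out: "z \<notin> convex hull {a, c, d}"
  proof
    assume "z \<in> convex hull {a, c, d}"
    then obtain u v w where "u \<ge> 0" "v \<ge> 0" "w \<ge> 0" "u + v + w = 1" "z = u *\<^sub>R a + v *\<^sub>R c + w *\<^sub>R d"
      unfolding convex_hull_3 by blast
    then have "area2 a c z * area2 a c d \<ge> 0"
      by (simp add: area2_convex) (metis mult.assoc mult_nonneg_nonneg zero_le_square)
    then show False using side by simp
  qed
  have sub: "closed_segment c d \<subseteq> convex hull {a, c, d}" "closed_segment d a \<subseteq> convex hull {a, c, d}"
      "closed_segment a c \<subseteq> convex hull {a, c, d}"
    unfolding segment_convex_hull by (rule hull_mono, blast)+
  note no = interior_triangle_outside_segment[OF z nz]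
  show notin: "z \<notin> path_image (quad a b c d)" using no out sub by auto
  have "winding_number (linepath a c +++ linepath c d +++ linepath d a) z = 0"
    by (rule winding_number_zero_outside[OF _ _ _ out]) (use sub in \<open>auto simp: path_image_join\<close>)
  moreover have ac: "z \<notin> closed_segment c d" "z \<notin> closed_segment d a" "z \<notin> closed_segment a c"
    using out sub by auto
  ultimately have e1: "winding_number (linepath a c) z + winding_number (linepath c d) z +
    winding_number (linepath d a) z = 0"
    by (simp add: winding_number_join path_image_join add.assoc)
  have e2: "winding_number (linepath a b) z +
    winding_number (linepath b c) z - winding_number (linepath a c) z
      = sgn (area2 a b c)"
    using winding_number_triangle_area2[OF z nz] no winding_number_linepath_swap[OF ac(3)]
    by (simp add: winding_number_join path_image_join algebra_simps)
  have "winding_number (quad a b c d) z =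
      (winding_number (linepath a b) z +
        winding_number (linepath b c) z - winding_number (linepath a c) z) +
      (winding_number (linepath a c) z + winding_number (linepath c d) z + winding_number (linepath d a) z)"
    using winding_number_quad[OF notin] by simp
  then show "winding_number (quad a b c d) z = sgn (area2 a b c)" unfolding e1 e2 by simp
qed

lemma quad_rotate:
  "path_image (quad b c d a) = path_image (quad a b c d)"
  "z \<notin> path_image (quad a b c d) \<Longrightarrow> winding_number (quad b c d a) z = winding_number (quad a b c d) z"
proof -
  show 1: "path_image (quad b c d a) = path_image (quad a b c d)" by auto
  show "z \<notin> path_image (quad a b c d) \<Longrightarrow> winding_number (quad b c d a) z = winding_number (quad a b c d) z"
    using winding_number_quad[of z a b c d] winding_number_quad[of z b c d a] 1 by simp
qed

text \<open>A point on the diagonal \<open>a c\<close> is not covered by the decomposition. It is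
  approximated by interior points of the triangle, whose nonzero winding number keeps them from the
  outside; a ball missing the path joins them to \<open>z\<close>.\<close>

lemma triangle_in_inside:
  assumes z: "z \<in> convex hull {a, b, c}" and s: "area2 a b c * area2 a c d > 0" and n:
    "z \<notin> path_image (quad a b c d)"
  shows "z \<in> inside (path_image (quad a b c d))"
proof -
  let ?T = "convex hull {a, b, c}" and ?p = "path_image (quad a b c d)"
  have nz: "area2 a b c \<noteq> 0" using s by auto
  have "open (- ?p)" by (intro open_Compl closed_path_image) simp
  with n obtain e where e: "e > 0" "ball z e \<subseteq> - ?p" using openE[of "- ?p" z] by blast
  have "z \<in> closure (interior ?T)"
    using z convex_closure_interior[OF convex_convex_hull interior_triangle_nonempty[OF nz]] closure_subset
      by blast
  then obtain y where y: "y \<in> interior ?T" "dist y z < e" using e closure_approachable by blast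
  have "winding_number (quad a b c d) y \<noteq> 0" using winding_number_quad_triangle(2)[OF y(1) s] nz
    by (simp add: sgn_if)
  then have "y \<notin> outside ?p" using winding_number_zero_in_outside[of "quad a b c d"]
    by (metis quad_path(1-3))
  then have "y \<in> inside ?p" using winding_number_quad_triangle(1)[OF y(1) s] inside_Un_outside[of ?p]
    by blast
  moreover have "connected_component (- ?p) y z"
    unfolding connected_component_def
    using e y by (intro exI[of _ "ball z e"]) (auto simp: dist_commute)
  ultimately show ?thesis using inside_same_component by blast
qed

section \<open>Directions that point from a corner into the quadrilateral\<close>

lemma cross_expand: "cross c a *\<^sub>R d = cross d a *\<^sub>R c + cross c d *\<^sub>R a"
  by (simp add: cross_def complex_eq_iff algebra_simps)

text \<open>By Cramer's rule \<open>d\<close> has nonnegative coefficients in \<open>c\<close> and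
  \<open>a\<close>, so a short step from \<open>v\<close> stays in the triangle.\<close>

lemma cone_triangle:
  assumes "cross c a > 0" "cross d a \<ge> 0" "cross c d \<ge> 0"
  shows "\<exists>e0>0. \<forall>e. 0 < e \<longrightarrow> e \<le> e0 \<longrightarrow> v + e *\<^sub>R d \<in> convex hull {v, v + c, v + a}"
proof -
  define s t where "s = cross d a / cross c a" and "t = cross c d / cross c a"
  have st: "s \<ge> 0" "t \<ge> 0" using assms by (auto simp: s_def t_def)
  have "cross c a *\<^sub>R d = cross c a *\<^sub>R (s *\<^sub>R c + t *\<^sub>R a)"
    using assms(1) cross_expand[of c a d] by (simp add: s_def t_def scaleR_right_distrib)
  then have d: "d = s *\<^sub>R c + t *\<^sub>R a" using assms(1) by simp
  show ?thesis
  \<comment> \<open>This bound keeps the barycentric weight \<open>1 - e * s - e * t\<close> of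
    \<open>v\<close> nonnegative; the summand 1 covers \<open>s = t = 0\<close>.\<close>
  proof (intro exI[of _ "1 / (s + t + 1)"] conjI allI impI)
    show "1 / (s + t + 1) > 0" using st by simp
    fix e :: real assume e: "0 < e" "e \<le> 1 / (s + t + 1)"
    then have "e * (s + t + 1) \<le> 1" using st by (simp add: field_simps)
    then have "e * s + e * t \<le> 1" using e by (simp add: algebra_simps)
    moreover have "v + e *\<^sub>R d = (1 - e * s - e * t) *\<^sub>R v + (e * s) *\<^sub>R (v + c) + (e * t) *\<^sub>R (v + a)"
      unfolding d by (simp add: algebra_simps)
    ultimately show "v + e *\<^sub>R d \<in> convex hull {v, v + c, v + a}"
      unfolding convex_hull_3 using e st by (intro CollectI exI conjI) (assumption | simp)+
  qed
qed

lemma not_ccw_cone: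
  assumes "cross c a > 0" "\<not> ccw a d c"
  shows "cross d a \<ge> 0" "cross c d \<ge> 0"
  using assms cross_commute[of d a] cross_commute[of d c] by (auto simp: ccw_def)

text \<open>\<open>m\<close> is the direction of a diagonal. It splits the corner, possibly a reflex
  one, into two sectors of less than half a turn, and a direction not strictly outside the corner
  lies in one of them.\<close>

lemma not_ccw_two_cones:
  assumes m: "cross c m > 0" "cross m a > 0" and n: "\<not> ccw a d c"
  shows "cross d m \<ge> 0 \<and> cross c d \<ge> 0 \<or> cross d a \<ge> 0 \<and> cross m d \<ge> 0"
proof (cases "cross c a > 0")
  case True
  then show ?thesis using not_ccw_cone[OF True n] cross_commute[of d m] by linarith
next
  case False
  have "cross c m * cross a d + cross m a * cross c d = cross c a * cross m d"
    by (simp add: cross_def algebra_simps)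
  then show ?thesis
    using assms False zero_less_mult_iff[of "cross c m" "cross a d"] mult_less_0_iff[of "cross c m"
      "cross a d"]
       zero_less_mult_iff[of "cross m a" "cross c d"] mult_less_0_iff[of "cross m a" "cross c d"]
       zero_less_mult_iff[of "cross c a" "cross m d"] mult_less_0_iff[of "cross c a" "cross m d"]
    unfolding ccw_def cross_commute[of d a] cross_commute[of d m] cross_commute[of d c]
    by argo
qed

text \<open>One of the two diagonals cuts the quadrilateral into two clockwise triangles, which covers
  quadrilaterals with a reflex or a straight corner.\<close>

definition clockwise_quad :: "complex \<Rightarrow> complex \<Rightarrow> complex \<Rightarrow> complex \<Rightarrow> bool" where
  "clockwise_quad a b c d \<longleftrightarrow>
     area2 a b c < 0 \<and> area2 a c d < 0 \<or> area2 b c d < 0 \<and> area2 b d a < 0"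

lemma clockwise_quad_rotate: "clockwise_quad a b c d \<Longrightarrow> clockwise_quad b c d a"
  unfolding clockwise_quad_def using area2_rotate by metis

text \<open>A direction violating the cyclic order enters a triangle of the decomposition, so its
  points for small \<open>e\<close> are inside or on the path. The diagonal \<open>a c\<close>
  splits the corner at \<open>a\<close> into two sectors; if \<open>b d\<close> is the cut instead,
  that corner is a convex corner of the triangle \<open>d a b\<close>.\<close>

lemma clockwise_quad_exterior:
  assumes q: "clockwise_quad a b c d"
    and out: "\<And>e. 0 < e \<Longrightarrow> e < 1 \<Longrightarrow> a +
      e *\<^sub>R x \<notin> inside (path_image (quad a b c d)) \<union> path_image (quad a b c d)"
  shows "ccw (b - a) x (d - a)"
proof (rule ccontr)
  assume n: "\<not> ccw (b - a) x (d - a)"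
  have no: False if h: "\<exists>e0>0. \<forall>e. 0 < e \<longrightarrow> e \<le> e0 \<longrightarrow> a + e *\<^sub>R x \<in> T"
    and T: "T \<subseteq> inside (path_image (quad a b c d)) \<union> path_image (quad a b c d)" for T
  proof -
    obtain e0 where e0: "e0 > 0" "\<forall>e. 0 < e \<longrightarrow> e \<le> e0 \<longrightarrow> a + e *\<^sub>R x \<in> T" using h by blast
    have "a + min e0 (1/2) *\<^sub>R x \<in> T" using e0 by (intro e0(2)[rule_format]) auto
    moreover have "0 < min e0 (1/2)" "min e0 (1/2) < 1" using e0(1) by auto
    ultimately show False using out T by blast
  qed
  from q consider "area2 a b c < 0" "area2 a c d < 0" | "area2 b c d < 0" "area2 b d a < 0"
    unfolding clockwise_quad_def by blast
  then show False
  proof cases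
    case 1
    have abc: "convex hull {a, b, c} \<subseteq> inside (path_image (quad a b c d)) \<union> path_image (quad a b c d)"
      using triangle_in_inside[of _ a b c d] mult_neg_neg[OF 1] by blast
    have "area2 c d a * area2 c a b > 0"
      using mult_neg_neg[OF 1] by (metis area2_rotate mult.commute)
    then have "convex hull {c, d, a} \<subseteq> inside (path_image (quad c d a b)) \<union> path_image (quad c d a b)"
      using triangle_in_inside[of _ c d a b] by blast
    moreover have "path_image (quad c d a b) = path_image (quad a b c d)" "{c, d, a} = {a, d, c}" by auto
    ultimately have cda: "convex hull {a, d, c} \<subseteq>
      inside (path_image (quad a b c d)) \<union> path_image (quad a b c d)"
      by simp
    have abc': "{a, c, b} = {a, b, c}" by auto
    have m: "cross (d - a) (c - a) > 0" "cross (c - a) (b - a) > 0"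
      using 1 by (auto simp: area2_def cross_commute[of "d - a"] cross_commute[of "c - a" "b - a"])
    from not_ccw_two_cones[OF m n] show False
    proof
      assume "0 \<le> cross x (c - a) \<and> 0 \<le> cross (d - a) x"
      then show False using cone_triangle[OF m(1), of x a] no[OF _ cda] by simp
    next
      assume "0 \<le> cross x (b - a) \<and> 0 \<le> cross (c - a) x"
      then show False using cone_triangle[OF m(2), of x a] no[OF _ abc] by (simp add: abc')
    qed
  next
    case 2
    have "area2 d a b * area2 d b c > 0"
      using mult_neg_neg[OF 2] by (metis area2_rotate mult.commute)
    then have "convex hull {d, a, b} \<subseteq> inside (path_image (quad d a b c)) \<union> path_image (quad d a b c)"
      using triangle_in_inside[of _ d a b c] by blast
    moreover have "path_image (quad d a b c) = path_image (quad a b c d)" "{d, a, b} = {a, d, b}" by auto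
    ultimately have dab: "convex hull {a, d, b} \<subseteq>
      inside (path_image (quad a b c d)) \<union> path_image (quad a b c d)"
      by simp
    have m: "cross (d - a) (b - a) > 0"
      using 2 area2_rotate[of b d a] cross_commute[of "d - a" "b - a"] by (simp add: area2_def)
    show False using cone_triangle[OF m not_ccw_cone[OF m n], of a] no[OF _ dab] by simp
  qed
qed

section \<open>Simple quadrilaterals with winding number -1 are clockwise\<close>

lemma cross_zero_parallel:
  assumes "cross u v = 0" "u \<noteq> 0" obtains k where "v = k *\<^sub>R u"
proof -
  have "Re u * Im v = Im u * Re v" using assms(1) by (simp add: cross_def)
  then have "inner u u * Re v = inner u v * Re u" "inner u u * Im v = inner u v * Im u"
    unfolding inner_complex_def by algebra+
  then have "inner u u *\<^sub>R v = inner u v *\<^sub>R u" by (simp add: complex_eq_iff)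
  then have "v = (inner u v / inner u u) *\<^sub>R u"
    using assms(2) by (metis (no_types) divide_inverse_commute inner_eq_zero_iff scaleR_one scaleR_scaleR
      left_inverse)
  then show ?thesis using that by blast
qed

text \<open>A corner of zero area goes straight on or folds back. Folding back would put the far end
  of the shorter segment on the other one: \<open>a\<close> if \<open>k \<le> -1\<close>, and
  \<open>c\<close> if \<open>-1 < k < 0\<close>.\<close>

lemma straight_corner:
  assumes "closed_segment a b \<inter> closed_segment b c \<subseteq> {b}" "a \<noteq> b" "b \<noteq> c" "area2 a b c = 0"
  obtains k where "k > 0" "c - b = k *\<^sub>R (b - a)"
proof -
  have "cross (b - a) (c - b) = 0" using assms(4) by (simp add: area2_def cross_def algebra_simps)
  then obtain k where k: "c - b = k *\<^sub>R (b - a)" using cross_zero_parallel assms(2)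
    by (metis right_minus_eq)
  have "k > 0"
  proof (rule ccontr)
    assume "\<not> k > 0"
    then consider "k = 0" | "k \<le> -1" | "-1 < k" "k < 0" by linarith
    then show False
    proof cases
      case 1 then show False using k assms(3) by simp
    next
      case 2
      have "(c - b) /\<^sub>R k = b - a" using k 2 by simp
      then have "a = (1 - (- (1/k))) *\<^sub>R b + (- (1/k)) *\<^sub>R c" by (simp add: algebra_simps inverse_eq_divide)
      moreover have "0 \<le> - (1/k)" "- (1/k) \<le> 1" using 2 by (auto simp: field_simps)
      ultimately have "a \<in> closed_segment b c" unfolding in_segment by blast
      then show False using assms(1,2) by auto
    next
      case 3
      have "c = (1 - (1 + k)) *\<^sub>R a + (1 + k) *\<^sub>R b" using k by (simp add: algebra_simps)
      then have "c \<in> closed_segment a b" unfolding in_segment using 3 by (intro exI[of _ "1 + k"]) auto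
      then show False using assms(1,3) by auto
    qed
  qed
  with k that show ?thesis by blast
qed

text \<open>Division by the common total \<open>p + q\<close> turns both sides into convex
  combinations; nonpositive weights work as well, because then the total is negative.\<close>

lemma segments_meet:
  assumes "p *\<^sub>R a + q *\<^sub>R b = r *\<^sub>R c + s *\<^sub>R d" "p + q = r + s" "p + q \<noteq> 0"
    "p \<ge> 0 \<and> q \<ge> 0 \<and> r \<ge> 0 \<and> s \<ge> 0 \<or> p \<le> 0 \<and> q \<le> 0 \<and> r \<le> 0 \<and> s \<le> 0"
  shows "closed_segment a b \<inter> closed_segment c d \<noteq> {}"
proof -
  define n where "n = p + q"
  have *: "(p' / n) *\<^sub>R a' + (q' / n) *\<^sub>R b' \<in> closed_segment a' b'"
    if "p' + q' = n" "p' \<ge> 0 \<and> q' \<ge> 0 \<or> p' \<le> 0 \<and> q' \<le> 0" for p' q' a' b'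
    unfolding in_segment using that assms(3)
    by (intro exI[of _ "q' / n"]) (auto simp: n_def field_simps divide_nonpos_neg)
  have "(p / n) *\<^sub>R a + (q / n) *\<^sub>R b = (1 / n) *\<^sub>R (p *\<^sub>R a + q *\<^sub>R b)" by (simp add: algebra_simps)
  also have "\<dots> = (r / n) *\<^sub>R c + (s / n) *\<^sub>R d" unfolding assms(1) by (simp add: algebra_simps)
  finally show ?thesis using *[of p q a b] *[of r s c d] assms n_def by (metis IntI empty_iff)
qed

text \<open>If a diagonal cut off two anticlockwise triangles, some inside point would have winding
  number 1. If instead neither diagonal gives two triangles of the same strict orientation, two
  opposite sides meet, or the four points are collinear and the path cannot close up.\<close>

lemma simple_quad_clockwise:
  assumes simple: "closed_segment a b \<inter> closed_segment b c \<subseteq> {b}"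
    "closed_segment b c \<inter> closed_segment c d \<subseteq> {c}"
    "closed_segment c d \<inter> closed_segment d a \<subseteq> {d}"
    "closed_segment a b \<inter> closed_segment c d = {}" "closed_segment b c \<inter> closed_segment d a = {}"
    and dist: "a \<noteq> b" "b \<noteq> c" "c \<noteq> d"
    and wn: "\<And>z. z \<in> inside (path_image (quad a b c d)) \<Longrightarrow> winding_number (quad a b c d) z = - 1"
  shows "clockwise_quad a b c d"
proof (rule ccontr)
  assume neg: "\<not> clockwise_quad a b c d"
  define A B C D where d: "A = area2 a b c" "B = area2 b c d" "C = area2 a c d" "D = area2 b d a"
  have pos: False if "area2 p q r > 0" "area2 p r s > 0"
    "path_image (quad p q r s) = path_image (quad a b c d)"
    "\<And>z. z \<notin> path_image (quad a b c d) \<Longrightarrow> winding_number (quad p q r s) z = winding_number (quad a b c d) z"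
    for p q r s
  proof -
    have "area2 p q r \<noteq> 0" using that(1) by simp
    then obtain z where z: "z \<in> interior (convex hull {p, q, r})" using interior_triangle_nonempty by blast
    have 0: "area2 p q r * area2 p r s > 0" using that by simp
    have "z \<in> inside (path_image (quad a b c d))"
      using triangle_in_inside[of z p q r s] z interior_subset winding_number_quad_triangle(1)[OF z 0] 0
        that(3) by auto
    then have "winding_number (quad a b c d) z = - 1" "z \<notin> path_image (quad a b c d)"
      using wn inside_no_overlap by blast+
    then show False using winding_number_quad_triangle(2)[OF z 0] that by auto
  qed
  have "\<not> (A > 0 \<and> C > 0)" using pos[of a b c d] d by blast
  moreover have "\<not> (B > 0 \<and> D > 0)" using pos[OF _ _ quad_rotate(1)[of b c d a] quad_rotate(2)] d by blast
  ultimately have signs: "A \<ge> 0 \<and> C \<le> 0 \<or> A \<le> 0 \<and> C \<ge> 0" "B \<ge> 0 \<and> D \<le> 0 \<or> B \<le> 0 \<and> D \<ge> 0"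
    using neg unfolding clockwise_quad_def d by linarith+
  have sum: "A + C = B + D" by (simp add: d area2_def cross_def algebra_simps)
  \<comment> \<open>The affine dependency of four points in the plane. With the signs at hand it exhibits a common
     point of two opposite sides.\<close>
  have rel: "B *\<^sub>R a + D *\<^sub>R c = C *\<^sub>R b + A *\<^sub>R d"
    by (simp add: d area2_def cross_def complex_eq_iff algebra_simps)
  show False
  proof (cases "A = 0 \<and> B = 0 \<and> C = 0 \<and> D = 0")
    case True
    then have z: "area2 a b c = 0" "area2 b c d = 0" using d by simp_all
    obtain k1 where k1: "k1 > 0" "c - b = k1 *\<^sub>R (b - a)"
      using straight_corner[OF simple(1) dist(1,2) z(1)] by blast
    obtain k2 where k2: "k2 > 0" "d - c = k2 *\<^sub>R (c - b)"
      using straight_corner[OF simple(2) dist(2,3) z(2)] by blast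
    have "area2 c d a = 0" using True d area2_rotate by metis
    moreover have "d \<noteq> a" using simple(4) by auto
    ultimately obtain k3 where k3: "k3 > 0" "a - d = k3 *\<^sub>R (d - c)"
      using straight_corner[OF simple(3) dist(3)] by blast
    \<comment> \<open>All sides are positive multiples of \<open>b - a\<close>, yet the sides of a
      closed path add up to zero.\<close>
    have "(1 + k1 + k2 * k1 + k3 * k2 * k1) *\<^sub>R (b - a) = (b - a) + (c - b) + (d - c) + (a - d)"
      unfolding k3 k2 k1 by (simp add: algebra_simps)
    then have "1 + k1 + k2 * k1 + k3 * k2 * k1 = 0" using dist(1) by simp
    moreover have "k2 * k1 > 0" "k3 * k2 * k1 > 0" using k1 k2 k3 by simp_all
    ultimately show False using k1 by linarith
  next
    case nz: False
    \<comment> \<open>The first regrouping of \<open>rel\<close> yields a common point of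
      \<open>a b\<close> and \<open>c d\<close>, the second one of \<open>b c\<close> and
      \<open>d a\<close>; the signs decide which has all its weights of one sign.\<close>
    have 1: "B *\<^sub>R a + (- C) *\<^sub>R b = (- D) *\<^sub>R c + A *\<^sub>R d" "(- C) *\<^sub>R b + D *\<^sub>R c = A *\<^sub>R d + (- B) *\<^sub>R a"
      using rel by (simp_all add: algebra_simps)
    from signs nz sum have
      "(B + - C \<noteq> 0 \<and> (B \<ge> 0 \<and> - C \<ge> 0 \<and> - D \<ge> 0 \<and> A \<ge> 0 \<or> B \<le> 0 \<and> - C \<le> 0 \<and> - D \<le> 0 \<and> A \<le> 0)) \<or>
       (- C + D \<noteq> 0 \<and> (- C \<ge> 0 \<and> D \<ge> 0 \<and> A \<ge> 0 \<and> - B \<ge> 0 \<or> - C \<le> 0 \<and> D \<le> 0 \<and> A \<le> 0 \<and> - B \<le> 0))"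
      by argo
    then show False
      using segments_meet[OF 1(1)] segments_meet[OF 1(2)] sum simple(4,5) by fastforce
  qed
qed

text \<open>The areas at opposite corners have equal sums. One opposite pair is negative by
  definition, hence so is a member of the other pair, and three consecutive corners are
  clockwise.\<close>

lemma wsign_clockwise_quad:
  assumes q: "clockwise_quad a b c d"
    and l: "cross (b - a) l \<noteq> 0" "cross (c - b) l \<noteq> 0" "cross (d - c) l \<noteq> 0" "cross (a - d) l \<noteq> 0"
  shows "wsign l (b - a) (c - b) * wsign l (c - b) (d - c) * wsign l (d - c) (a - d) * wsign l (a - d) (b - a) = - 1"
proof -
  have e: "cross (b - a) (c - b) = area2 a b c" "cross (c - b) (d - c) = area2 b c d"
    "cross (d - c) (a - d) = area2 a c d" "cross (a - d) (b - a) = area2 b d a"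
    "area2 a b c + area2 a c d = area2 b c d + area2 b d a"
    by (simp_all add: area2_def cross_def algebra_simps)
  have s: "(b - a) + (c - b) + (d - c) + (a - d) = 0" "(c - b) + (d - c) + (a - d) + (b - a) = 0"
    "(d - c) + (a - d) + (b - a) + (c - b) = 0" "(a - d) + (b - a) + (c - b) + (d - c) = 0" by simp_all
  from q e(5) consider "area2 a b c < 0" "area2 b c d < 0" "area2 a c d < 0"
    | "area2 b c d < 0" "area2 a c d < 0" "area2 b d a < 0"
    | "area2 a c d < 0" "area2 b d a < 0" "area2 a b c < 0"
    | "area2 b d a < 0" "area2 a b c < 0" "area2 b c d < 0"
    unfolding clockwise_quad_def by linarith
  then show ?thesis
    using wsign_polygon[OF s(1) _ _ _ l] wsign_polygon[OF s(2) _ _ _ l(2,3,4,1)]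
      wsign_polygon[OF s(3) _ _ _ l(3,4,1,2)] wsign_polygon[OF s(4) _ _ _ l(4,1,2,3)]
    unfolding e by cases (simp_all add: mult_ac)
qed

text \<open>Only a straight corner at \<open>b\<close> needs an argument. Then \<open>b d\<close> is
  the cutting diagonal, and \<open>c - b\<close> is \<open>b - a\<close> scaled by the positive
  ratio of the two triangle areas.\<close>

lemma wsign_reverse_clockwise_quad:
  assumes q: "clockwise_quad a b c d"
    and l: "cross (b - a) l \<noteq> 0" "cross (c - b) l \<noteq> 0"
  shows "wsign l (b - a) (c - b) * wsign l (b - c) (a - b) = gsign l (b - a) * gsign l (c - b)"
proof -
  have "gsign l (b - a) = gsign l (c - b)" if "cross (b - a) (c - b) = 0"
  proof -
    have e: "area2 a b c = 0" "area2 a b c + area2 a c d = area2 b c d + area2 b d a"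
      using that by (simp_all add: area2_def cross_def algebra_simps)
    then have neg: "area2 b c d < 0" "area2 b d a < 0" using q unfolding clockwise_quad_def by auto
    have "area2 b d a * cross (c - b) l = area2 b c d * cross (b - a) l + area2 a b c * (cross (d - b) l)"
      by (simp add: area2_def cross_def algebra_simps)
    then have "area2 b d a * cross (c - b) l = area2 b c d * cross (b - a) l" using e by simp
    then have "(cross (c - b) l < 0) = (cross (b - a) l < 0)"
      using neg mult_less_0_iff[of "area2 b d a" "cross (c - b) l"] mult_less_0_iff[of "area2 b c d"
        "cross (b - a) l"]
        l zero_less_mult_iff[of "area2 b d a" "cross (c - b) l"] zero_less_mult_iff[of "area2 b c d"
          "cross (b - a) l"]
      by argo
    then show ?thesis by (simp add: gsign_def)
  qed
  then show ?thesis using wsign_reverse[of "b - a" "c - b" l] l by auto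
qed

section \<open>Translation of \<open>wind\<close> and \<open>gamma2\<close> into real signs\<close>

lemma gsign_minus: "cross a l \<noteq> 0 \<Longrightarrow> gsign l (- a) = - gsign l a"
  by (auto simp: gsign_def)

lemma wsign_cases: "wsign l a b = 1 \<or> wsign l a b = - 1"
  by (simp add: wsign_def)

lemma gsign_cases: "gsign l a = 1 \<or> gsign l a = - 1"
  by (simp add: gsign_def)

lemma wsign_square [simp]: "wsign l a b * wsign l a b = 1" "wsign l a b * (wsign l a b * x) = x"
  using wsign_cases[of l a b] by auto

lemma gsign_square [simp]: "gsign l a * gsign l a = 1" "gsign l a * (gsign l a * x) = x"
  using gsign_cases[of l a] by auto

lemma sg_add: "sg (j + k) = sg j * sg k"
  by (simp add: sg_def power_int_add)

lemma sg_int: "sg (int k) = (- 1) ^ k"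
  by (simp add: sg_def)

lemma sg_1: "sg 1 = - 1"
  by (simp add: sg_def)

lemma sg_wind:
  assumes "cross (dir e) l \<noteq> 0" "cross (dir f) l \<noteq> 0"
  shows "sg (wind l e f) = wsign l (dir e) (dir f)"
  using assms cross_commute[of l "dir f"]
  by (auto simp: sg_def wind_def orient_def wsign_def passes_def)

lemma sg_gamma2:
  assumes "cross (dir e) l \<noteq> 0"
  shows "sg (gamma2 l e) = gsign l (dir e)"
  using assms by (auto simp: sg_def gamma2_def orient_def gsign_def)

section \<open>Geometry of the network\<close>

lemma out_edgesD: "f \<in> out_edges N v \<Longrightarrow> f \<in> edges N \<and> fst f = v"
  by (simp add: out_edges_def)

lemma finite_edges: "plabic_network N \<Longrightarrow> finite (edges N)"
  unfolding plabic_network_def planar_straight_graph_def by (meson finite_SigmaI finite_subset)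

section \<open>Intersections of gauge rays with edges between internal vertices\<close>

lemma cross_affine: "cross l ((1 - t) *\<^sub>R x + t *\<^sub>R y - b) = (1 - t) * cross l (x - b) +
  t * cross l (y - b)"
  by (simp add: cross_def algebra_simps)

text \<open>An interior point of the disk on the backward half of the line, together with an
  interior point \<open>y\<close> on the ray, would by convexity make the base point interior, but
  that point is on the frontier.\<close>

lemma gauge_ray_interior:
  assumes N: "plabic_network N" "gauge_direction N l" and z: "z \<in> interior (disk N)"
  shows "z \<in> gauge_ray N l j \<longleftrightarrow> cross l (z - bdry N j) = 0"
proof
  assume "z \<in> gauge_ray N l j"
  then show "cross l (z - bdry N j) = 0" by (auto simp: gauge_ray_def cross_def)
next
  let ?b = "bdry N j"
  assume c: "cross l (z - ?b) = 0"
  obtain y s where y: "y \<in> interior (disk N)" "s > 0" "y = ?b + s *\<^sub>R l"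
    using N(2) unfolding gauge_direction_def gauge_ray_def by blast
  have b: "?b \<notin> interior (disk N)"
    using N(1) unfolding plabic_network_def vertices_in_disk_def frontier_def by blast
  have "l \<noteq> 0" using y b by auto
  then obtain t where t: "z - ?b = t *\<^sub>R l" using cross_zero_parallel[OF c] by blast
  have "t > 0"
  proof (rule ccontr)
    assume "\<not> t > 0"
    \<comment> \<open>With \<open>y\<close> at parameter \<open>s > 0\<close> and \<open>z\<close>
      at \<open>t \<le> 0\<close> on the line, this weight gives parameter 0.\<close>
    moreover have "?b = (1 - s / (s - t)) *\<^sub>R y + (s / (s - t)) *\<^sub>R z" if "s - t > 0"
    proof -
      have z: "z = ?b + t *\<^sub>R l" using t by (simp add: algebra_simps)
      have "(1 - s / (s - t)) *\<^sub>R y + (s / (s - t)) *\<^sub>R z = ?b + ((1 - s / (s - t)) * s +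
        s / (s - t) * t) *\<^sub>R l"
        unfolding y(3) z by (simp add: algebra_simps)
      also have "(1 - s / (s - t)) * s + s / (s - t) * t = 0" using that by (simp add: field_simps)
      finally show ?thesis by simp
    qed
    ultimately have "?b \<in> closed_segment y z" unfolding in_segment using y(2)
      by (intro exI[of _ "s / (s - t)"]) (auto simp: field_simps)
    moreover have "convex (interior (disk N))"
      using N(1) unfolding plabic_network_def closed_convex_disk_def by (blast intro: convex_interior)
    ultimately show False using b y(1) z closed_segment_subset by blast
  qed
  then show "z \<in> gauge_ray N l j" using t unfolding gauge_ray_def
    by (auto simp: algebra_simps intro!: exI[of _ t])
qed

text \<open>Along the edge, \<open>cross l\<close> of the difference to the base point is affine and
  vanishes exactly on the ray. It is nonzero at both ends, since gauge rays avoid internal vertices,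
  so it has one zero if the signs at the ends differ and none otherwise.\<close>

lemma card_gauge_ray_seg:
  assumes N: "plabic_network N" "gauge_direction N l" and e: "e \<in> edges N" "fst e \<in> internal N"
    "snd e \<in> internal N"
  shows "card (gauge_ray N l j \<inter> seg e) =
    (if cross l (fst e - bdry N j) > 0 \<longleftrightarrow> cross l (snd e - bdry N j) > 0 then 0 else 1)"
proof -
  let ?b = "bdry N j"
  have int: "internal N \<subseteq> interior (disk N)" and cx: "convex (interior (disk N))"
    using N(1) unfolding plabic_network_def vertices_in_disk_def closed_convex_disk_def
    by (blast intro: convex_interior)+
  have nz: "cross l (v - ?b) \<noteq> 0" if "v \<in> internal N" for v
    using that int gauge_ray_interior[OF N, of v j] N(2) unfolding gauge_direction_def by blast
  define x y where "x = cross l (fst e - ?b)" and "y = cross l (snd e - ?b)"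
  have xy: "x \<noteq> 0" "y \<noteq> 0" using nz e unfolding x_def y_def by auto
  define pt where "pt t = (1 - t) *\<^sub>R fst e + t *\<^sub>R snd e" for t :: real
  have seg: "seg e = pt ` {0..1}" unfolding seg_def pt_def by (auto simp: in_segment)
  have "seg e \<subseteq> interior (disk N)" unfolding seg_def using e int cx closed_segment_subset by blast
  then have ray: "pt t \<in> gauge_ray N l j \<longleftrightarrow> (1 - t) * x + t * y = 0" if "0 \<le> t" "t \<le> 1" for t
    using gauge_ray_interior[OF N, of "pt t" j] that cross_affine unfolding seg x_def y_def pt_def
      by fastforce
  show ?thesis
  proof (cases "(x > 0) = (y > 0)")
    case True
    have "(1 - t) * x + t * y \<noteq> 0" if "0 \<le> t" "t \<le> 1" for t
    proof (cases "x > 0")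
      case True
      then have "(1 - t) * min x y + t * min x y \<le> (1 - t) * x + t * y"
        using that by (intro add_mono mult_left_mono) auto
      then show ?thesis using True \<open>(x > 0) = (y > 0)\<close> by (simp add: algebra_simps)
    next
      case False
      have "(1 - t) * x + t * y \<le> (1 - t) * max x y + t * max x y"
        using that by (intro add_mono mult_left_mono) auto
      then show ?thesis using False \<open>(x > 0) = (y > 0)\<close> xy by (simp add: algebra_simps)
    qed
    then have "gauge_ray N l j \<inter> seg e = {}" using ray unfolding seg by auto
    then show ?thesis using True unfolding x_def y_def by simp
  next
    case False
    define t where "t = x / (x - y)"
    have d: "x - y \<noteq> 0" "0 \<le> t" "t \<le> 1" using False xy unfolding t_def by (auto simp: field_simps)
    have "(1 - t') * x + t' * y = 0 \<longleftrightarrow> t' = t" for t' using d(1) unfolding t_def by (auto simp: field_simps)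
    then have "gauge_ray N l j \<inter> seg e = {pt t}" using ray d unfolding seg by auto
    then show ?thesis using False unfolding x_def y_def by auto
  qed
qed

text \<open>For each source, a side counts when its ends lie on different sides of the line of the
  ray, and a closed tour of four vertices changes sides an even number of times.\<close>

lemma even_int_num_quad:
  assumes N: "plabic_network N" "gauge_direction N l"
    and e: "{(a, b), (b, c), (c, d), (a, d)} \<subseteq> edges N" and i: "{a, b, c, d} \<subseteq> internal N"
  shows "even (int_num N l (a, b) + int_num N l (b, c) + int_num N l (c, d) + int_num N l (a, d))"
  unfolding int_num_def sum.distrib[symmetric]
  by (rule dvd_sum) (use e i in \<open>simp add: card_gauge_ray_seg[OF N]\<close>)

lemma seg_swap: "seg (prod.swap e) = seg e"
  by (simp add: seg_def closed_segment_commute)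

lemma int_num_swap: "int_num N l (prod.swap e) = int_num N l e"
  by (simp add: int_num_def seg_swap)

section \<open>The square in the network: incident edges and cyclic orders\<close>

locale square_network =
  fixes N :: "'n::{finite,linorder} network" and l S P Q R :: complex
  assumes network: "plabic_network N" "gauge_direction N l"
    and square: "square_config N S P Q R"
begin

definition square_edges :: "edge set" where
  "square_edges = {(S, P), (S, R), (P, Q), (Q, R)}"

lemma square_edges_subset: "square_edges \<subseteq> edges N"
  using square by (simp add: square_edges_def square_config_def)

lemma square_internal: "{S, P, Q, R} \<subseteq> internal N"
  using square by (simp add: square_config_def)

lemma square_distinct: "distinct [S, P, Q, R]"
  using square by (simp add: square_config_def)

lemma planar:
  "e \<in> edges N \<Longrightarrow> e' \<in> edges N \<Longrightarrow> e \<noteq> e' \<Longrightarrow> seg e \<inter> seg e' \<subseteq> {fst e, snd e} \<inter> {fst e', snd e'}"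
  "e \<in> edges N \<Longrightarrow> fst e \<noteq> snd e"
  using network(1) unfolding plabic_network_def planar_straight_graph_def by blast+

text \<open>An edge and its reverse would share a midpoint, while planarity lets distinct edges meet
  in end points only. Hence the edges created by the move are new.\<close>

lemma swap_notin_edges: "e \<in> edges N \<Longrightarrow> prod.swap e \<notin> edges N"
proof
  assume e: "e \<in> edges N" "prod.swap e \<in> edges N"
  have ne: "fst e \<noteq> snd e" using planar(2) e(1) by blast
  then have "prod.swap e \<noteq> e" by (metis fst_swap)
  then have "seg e \<subseteq> {fst e, snd e}" using planar(1)[OF e] seg_swap[of e] by auto
  moreover have "midpoint (fst e) (snd e) \<in> seg e" by (simp add: seg_def)
  ultimately show False using ne by auto
qed

lemma degree_edges:
  assumes "v \<in> {S, P, Q, R}"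
  shows "finite (in_edges N v)" "finite (out_edges N v)"
    "v \<in> {S, Q} \<Longrightarrow> card (in_edges N v) = 1 \<and> card (out_edges N v) = 2"
    "v \<in> {P, R} \<Longrightarrow> card (in_edges N v) = 2 \<and> card (out_edges N v) = 1"
proof -
  show "finite (in_edges N v)" "finite (out_edges N v)"
    using finite_edges[OF network(1)] by (simp_all add: in_edges_def out_edges_def)
  have "deg N v = 3" "v \<in> internal N" using square assms by (auto simp: square_config_def)
  moreover have "\<forall>v\<in>internal N. case colour N v of White \<Rightarrow> card (in_edges N v) =
    1 | Black \<Rightarrow> card (out_edges N v) = 1"
    using network(1) by (simp add: plabic_network_def perfect_def)
  ultimately have d: "card (in_edges N v) + card (out_edges N v) = 3"
     "case colour N v of White \<Rightarrow> card (in_edges N v) = 1 | Black \<Rightarrow> card (out_edges N v) = 1"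
    by (auto simp: deg_def)
  have c: "colour N S = White" "colour N Q = White" "colour N P = Black" "colour N R = Black"
    using square by (auto simp: square_config_def)
  show "v \<in> {S, Q} \<Longrightarrow> card (in_edges N v) = 1 \<and> card (out_edges N v) = 2"
    "v \<in> {P, R} \<Longrightarrow> card (in_edges N v) = 2 \<and> card (out_edges N v) = 1"
    using d c by auto
qed

lemma square_vertex_edges:
  "in_edges N Q = {(P, Q)}" "in_edges N R = {(S, R), (Q, R)}"
  "out_edges N S = {(S, P), (S, R)}" "out_edges N P = {(P, Q)}"
  "\<exists>e. e \<notin> square_edges \<and> out_edges N Q = {(Q, R), e}" "\<exists>e. e \<notin> square_edges \<and> out_edges N R = {e}"
proof -
  have E: "(S, P) \<in> edges N" "(P, Q) \<in> edges N" "(Q, R) \<in> edges N" "(S, R) \<in> edges N"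
    using square_edges_subset by (auto simp: square_edges_def)
  have ne: "S \<noteq> P" "S \<noteq> Q" "S \<noteq> R" "P \<noteq> Q" "P \<noteq> R" "Q \<noteq> R" using square_distinct by auto
  show "in_edges N Q = {(P, Q)}"
    by (rule card_subset_eq[symmetric]) (use degree_edges[of Q] E in \<open>auto simp: in_edges_def\<close>)
  show "in_edges N R = {(S, R), (Q, R)}"
    by (rule card_subset_eq[symmetric]) (use degree_edges[of R] E ne in \<open>auto simp: in_edges_def\<close>)
  show "out_edges N S = {(S, P), (S, R)}"
    by (rule card_subset_eq[symmetric]) (use degree_edges[of S] E ne in \<open>auto simp: out_edges_def\<close>)
  show "out_edges N P = {(P, Q)}"
    by (rule card_subset_eq[symmetric]) (use degree_edges[of P] E in \<open>auto simp: out_edges_def\<close>)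
  have sq: "f = (Q, R)" if "f \<in> square_edges" "fst f = Q" for f
    using that ne unfolding square_edges_def by (metis empty_iff fst_conv insert_iff)
  have sq': "f \<notin> square_edges" if "fst f = R" for f
    using that ne unfolding square_edges_def by (metis empty_iff fst_conv insert_iff)
  have "card (out_edges N Q) = 2" "(Q, R) \<in> out_edges N Q" using degree_edges[of Q] E
    by (auto simp: out_edges_def)
  then obtain e where "out_edges N Q = {(Q, R), e}" "e \<noteq> (Q, R)"
    unfolding card_2_iff by (metis doubleton_eq_iff insert_iff singleton_iff)
  moreover from this have "fst e = Q" using out_edgesD by blast
  ultimately show "\<exists>e. e \<notin> square_edges \<and> out_edges N Q = {(Q, R), e}"
    using sq by blast
  obtain e where "out_edges N R = {e}" using degree_edges(4)[of R] by (auto simp: card_1_singleton_iff)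
  moreover from this have "fst e = R" using out_edgesD by blast
  ultimately show "\<exists>e. e \<notin> square_edges \<and> out_edges N R = {e}"
    using sq' by blast
qed

lemma clockwise: "clockwise_quad S P Q R"
proof (rule simple_quad_clockwise)
  have E: "(S, P) \<in> edges N" "(P, Q) \<in> edges N" "(Q, R) \<in> edges N" "(S, R) \<in> edges N"
    using square_edges_subset by (auto simp: square_edges_def)
  show "closed_segment S P \<inter> closed_segment P Q \<subseteq> {P}" "closed_segment P Q \<inter> closed_segment Q R \<subseteq> {Q}"
    "closed_segment Q R \<inter> closed_segment R S \<subseteq> {R}"
    "closed_segment S P \<inter> closed_segment Q R = {}" "closed_segment P Q \<inter> closed_segment R S = {}"
    using planar(1)[OF E(1,2)] planar(1)[OF E(2,3)] planar(1)[OF E(3,4)] planar(1)[OF E(1,3)] planar(1)[OF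
      E(2,4)]
      square_distinct by (auto simp: seg_def closed_segment_commute[of R S])
  show "S \<noteq> P" "P \<noteq> Q" "Q \<noteq> R" using square_distinct by auto
  show "\<And>z. z \<in> inside (path_image (quad S P Q R)) \<Longrightarrow> winding_number (quad S P Q R) z = - 1"
    using square by (simp add: square_config_def del: quad_path)
qed

text \<open>A face is disjoint from the drawing, and planarity keeps all but the ends of
  \<open>e\<close> off the sides of the square.\<close>

lemma extra_edge_outside:
  assumes e: "e \<in> edges N" "e \<notin> square_edges" and t: "0 < t" "t < 1"
  shows "fst e + t *\<^sub>R dir e \<notin> inside (path_image (quad S P Q R)) \<union> path_image (quad S P Q R)"
proof -
  let ?z = "fst e + t *\<^sub>R dir e"
  have ne: "fst e \<noteq> snd e" using planar(2) e(1) by blast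
  have "?z = (1 - t) *\<^sub>R fst e + t *\<^sub>R snd e" by (simp add: dir_def algebra_simps)
  then have z: "?z \<in> open_segment (fst e) (snd e)" unfolding in_segment using ne t by blast
  then have seg: "?z \<in> seg e" "?z \<noteq> fst e" "?z \<noteq> snd e" by (auto simp: seg_def open_segment_def)
  have "inside (path_image (quad S P Q R)) \<in> components (disk N - drawing N)"
    using square unfolding square_config_def faces_def by (elim conjE)
  then have "inside (path_image (quad S P Q R)) \<subseteq> disk N - drawing N"
    by (rule in_components_subset)
  then have "?z \<notin> inside (path_image (quad S P Q R))" using seg(1) e(1) unfolding drawing_def by blast
  moreover have "?z \<notin> seg h" if "h \<in> square_edges" for h
    using planar(1)[OF e(1), of h] seg e(2) that square_edges_subset by blast
  then have "?z \<notin> path_image (quad S P Q R)"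
    by (auto simp: square_edges_def seg_def closed_segment_commute[of R S])
  ultimately show ?thesis by blast
qed

lemma extra_edge_outside':
  assumes e: "e \<in> edges N" "e \<notin> square_edges" and t: "0 < t" "t < 1"
  shows "snd e + t *\<^sub>R (- dir e) \<notin> inside (path_image (quad S P Q R)) \<union> path_image (quad S P Q R)"
proof -
  have "snd e + t *\<^sub>R (- dir e) = fst e + (1 - t) *\<^sub>R dir e" by (simp add: dir_def algebra_simps)
  then show ?thesis using extra_edge_outside[OF e, of "1 - t"] t by auto
qed

text \<open>Seen from its end point, an incoming edge is the ray \<open>- dir e\<close>; hence the
  minus signs at \<open>S\<close> and \<open>P\<close>.\<close>

lemma extra_edge_ccw:
  assumes e: "e \<in> edges N" "e \<notin> square_edges"
  shows "snd e = S \<Longrightarrow> ccw (P - S) (- dir e) (R - S)"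
    "snd e = P \<Longrightarrow> ccw (Q - P) (- dir e) (S - P)"
    "fst e = Q \<Longrightarrow> ccw (R - Q) (dir e) (P - Q)"
    "fst e = R \<Longrightarrow> ccw (S - R) (dir e) (Q - R)"
proof -
  note q = clockwise clockwise_quad_rotate[OF clockwise]
    clockwise_quad_rotate[OF clockwise_quad_rotate[OF clockwise]]
    clockwise_quad_rotate[OF clockwise_quad_rotate[OF clockwise_quad_rotate[OF clockwise]]]
  have p: "path_image (quad P Q R S) = path_image (quad S P Q R)"
    "path_image (quad Q R S P) = path_image (quad S P Q R)"
    "path_image (quad R S P Q) = path_image (quad S P Q R)"
    by auto
  show "snd e = S \<Longrightarrow> ccw (P - S) (- dir e) (R - S)"
    using clockwise_quad_exterior[OF q(1)] extra_edge_outside'[OF e] by blast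
  show "snd e = P \<Longrightarrow> ccw (Q - P) (- dir e) (S - P)"
    using clockwise_quad_exterior[OF q(2)] extra_edge_outside'[OF e] unfolding p by blast
  show "fst e = Q \<Longrightarrow> ccw (R - Q) (dir e) (P - Q)"
    using clockwise_quad_exterior[OF q(3)] extra_edge_outside[OF e] unfolding p by blast
  show "fst e = R \<Longrightarrow> ccw (S - R) (dir e) (Q - R)"
    using clockwise_quad_exterior[OF q(4)] extra_edge_outside[OF e] unfolding p by blast
qed

section \<open>Winding relations at the four vertices of the square\<close>

lemma generic: "e \<in> edges N \<Longrightarrow> cross (dir e) l \<noteq> 0"
  using network(2) by (simp add: gauge_direction_def)

lemma square_generic: "cross (P - S) l \<noteq> 0" "cross (R - S) l \<noteq> 0" "cross (Q - P) l \<noteq> 0"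
  "cross (R - Q) l \<noteq> 0"
  using generic square_edges_subset by (auto simp: square_edges_def dir_def)

lemma square_generic_swap:
  "cross (S - P) l \<noteq> 0" "cross (S - R) l \<noteq> 0" "cross (P - Q) l \<noteq> 0" "cross (Q - R) l \<noteq> 0"
  using square_generic by (auto simp: cross_def algebra_simps)

lemma wsign_Q:
  assumes e: "e \<in> edges N" "e \<notin> square_edges" "fst e = Q"
  shows "wsign l (Q - R) (dir e) = - gsign l (R - Q) * wsign l (Q - P) (R - Q) * wsign l (Q - P) (dir e)"
  using wsign_out[OF extra_edge_ccw(3)[OF e] square_generic(4) generic[OF e(1)] square_generic_swap(3)]
    wsign_cases[of l "Q - P" "dir e"] by auto

lemma wsign_square_polygon:
  "wsign l (P - S) (Q - P) * wsign l (Q - P) (R - Q) * wsign l (R - Q) (S - R) * wsign l (S - R) (P - S) =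
    - 1"
  using wsign_clockwise_quad[OF clockwise square_generic(1,3,4) square_generic_swap(2)] .

lemma wsign_P_corner:
  "wsign l (P - S) (Q - P) = - (wsign l (Q - P) (R - Q) * wsign l (R - Q) (S - R) * wsign l (S - R) (P - S))"
proof -
  have "wsign l (P - S) (Q - P) =
    (wsign l (P - S) (Q - P) * wsign l (Q - P) (R - Q) * wsign l (R - Q) (S - R) *
      wsign l (S - R) (P - S)) * (wsign l (Q - P) (R - Q) * wsign l (R - Q) (S - R) * wsign l (S - R) (P -
        S))"
    by (simp add: mult_ac)
  then show ?thesis unfolding wsign_square_polygon by simp
qed

lemma wsign_reverse_R:
  "wsign l (R - Q) (S - R) = - gsign l (R - Q) * gsign l (R - S) * wsign l (R - S) (Q - R)"
  using wsign_reverse_clockwise_quad[OF clockwise_quad_rotate[OF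
    clockwise_quad_rotate[OF clockwise]] square_generic(4) square_generic_swap(2)]
   wsign_cases[of l "R - S" "Q - R"] gsign_minus[OF square_generic(2)] by auto

lemma wsign_reverse_S:
  "wsign l (S - R) (P - S) = - gsign l (P - S) * gsign l (R - S) * wsign l (S - P) (R - S)"
  using wsign_reverse_clockwise_quad[OF clockwise_quad_rotate[OF clockwise_quad_rotate[OF
    clockwise_quad_rotate[OF clockwise]]] square_generic_swap(2) square_generic(1)]
   wsign_cases[of l "S - P" "R - S"] gsign_minus[OF square_generic(2)] by auto

lemma wsign_R:
  assumes e: "e \<in> edges N" "e \<notin> square_edges" "fst e = R"
  shows "wsign l (R - S) (dir e) * wsign l (R - Q) (dir e) = - gsign l (R - Q) * wsign l (R - S) (Q - R)"
  using wsign_out[OF extra_edge_ccw(4)[OF e] square_generic_swap(2) generic[OF e(1)] square_generic_swap(4)]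
    wsign_reverse_R gsign_minus[OF square_generic(2)] by auto

text \<open>The local relation at \<open>S\<close> contains the corner of the square there. The
  total turning trades it for the corners at \<open>P\<close>, \<open>Q\<close> and, reversed,
  \<open>R\<close>, whose windings occur in the old equations or in the stated formulas.\<close>

lemma wsign_S:
  assumes e: "e \<in> edges N" "e \<notin> square_edges" "snd e = S"
  shows "wsign l (dir e) (R - S) = - gsign l (R - Q) * wsign l (R - S) (Q - R) * wsign l (Q - P) (R - Q) *
    wsign l (dir e) (P - S) * wsign l (P - S) (Q - P)"
proof -
  have "cross (- dir e) l \<noteq> 0" using generic[OF e(1)] by simp
  then have "wsign l (dir e) (P - S) * wsign l (dir e) (R - S) =
    - gsign l (R - S) * wsign l (S - R) (P - S)"
    using wsign_in[OF extra_edge_ccw(1)[OF e] square_generic(1) _ square_generic(2)] by simp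
  then have "wsign l (dir e) (R - S) =
    - gsign l (R - S) * wsign l (S - R) (P - S) * wsign l (dir e) (P - S)"
    using wsign_square(2)[of l "dir e" "P - S" "wsign l (dir e) (R - S)"] by (simp add: mult_ac)
  then show ?thesis by (simp add: wsign_P_corner wsign_reverse_R mult_ac)
qed

text \<open>As in \<open>wsign_S\<close>, the corner at \<open>P\<close> is traded for the one at
  \<open>Q\<close> and the reversed ones at \<open>R\<close> and \<open>S\<close>.\<close>

lemma wsign_P:
  assumes e: "e \<in> edges N" "e \<notin> square_edges" "snd e = P"
  shows "wsign l (dir e) (S - P) = - gsign l (R - Q) * wsign l (R - S) (Q - R) * wsign l (Q - P) (R - Q) *
    wsign l (dir e) (Q - P) * wsign l (S - P) (R - S)"
proof -
  have "cross (- dir e) l \<noteq> 0" using generic[OF e(1)] by simp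
  then have "wsign l (dir e) (Q - P) * wsign l (dir e) (S - P) = gsign l (P - S) * wsign l (P - S) (Q - P)"
    using wsign_in[OF extra_edge_ccw(2)[OF e] square_generic(3) _ square_generic_swap(1)] gsign_minus[OF
      square_generic(1)]
    by simp
  then have "wsign l (dir e) (S - P) = gsign l (P - S) * wsign l (P - S) (Q - P) * wsign l (dir e) (Q - P)"
    using wsign_square(2)[of l "dir e" "Q - P" "wsign l (dir e) (S - P)"] by (simp add: mult_ac)
  then show ?thesis by (simp add: wsign_P_corner wsign_reverse_R wsign_reverse_S mult_ac)
qed

end

section \<open>The square move\<close>

text \<open>One coordinate of the problem: \<open>i\<close>, \<open>g\<close> and \<open>w\<close>
  stand for the signs of \<open>int_num\<close>, \<open>gamma2\<close> and \<open>wind\<close>, and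
  \<open>V3\<close>, \<open>V4\<close> for the vectors of the extra edges at \<open>R\<close> and
  \<open>Q\<close>. The first four conclusions are the new equations at the square edges. The last
  two say that edges entering \<open>S\<close> and \<open>P\<close> receive the same as before;
  \<open>p\<close> and \<open>q\<close> are their windings into \<open>h1\<close> and
  \<open>h3\<close>.\<close>

lemma square_move_algebra:
  fixes F3 F4 V3 V4 :: real
  assumes pos: "a1 > 0" "a2 > 0" "a3 > 0" "a4 > 0"
    and b: "b2 = a2 + a1 * a3 * a4" "b1 = a3 * a4 / b2" "b3 = a2 * a3 / b2" "b4 = a1 * a3 / b2"
    and sq: "i1 * i1 = 1" "i2 * i2 = 1" "i3 * i3 = 1" "i4 * i4 = 1" "g * g = 1" "w34 * w34 = 1"
      "w3 * w3 = 1"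
      "w43 * w43 = 1" "w24 * w24 = 1" "w2 * w2 = 1" "w12 * w12 = 1" "w13 * w13 = 1"
    and i: "i1 = i2 * i3 * i4"
    and w: "w2 * w43 = - g * w24" "w4 = - g * w34 * w3"
    and F: "F4 = i4 * a4 * (w43 * V3)" "F3 = i3 * a3 * (w34 * F4 + w3 * V4)"
    and G: "G4 = b4 * inverse a3 * - (i3 * i4 * g * w34) * F3 + b4 * (i4 * g) * F4"
      "G2 = a1 * - (i1 * g * w24 * w34) * F3 + a2 * inverse a4 * - (i2 * i4 * g * w24) * F4"
      "G1 = b1 * (i1 * w12) * G2" "G3 = - (i3 * i4 * g * w34) * a2 * inverse a1 * G4"
  shows "G1 = i1 * b1 * (w12 * G2)"
    "G2 = i2 * b2 * (w2 * V3 + w24 * G4)"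
    "G3 = i3 * b3 * (w3 * V4)"
    "G4 = i4 * b4 * (w4 * V4)"
    "- g * w24 * w34 * p * w13 * G2 = p * (i1 * a1 * (w13 * F3)) +
      (- g * w24 * w34 * p * w13) * (i2 * a2 * (w2 * V3))"
    "- g * w24 * w34 * q * w12 * G1 + q * G3 = q * F3"
proof -
  have sq': "x * (x * y) = y" if "x * x = 1" for x y :: real using that by (metis mult.assoc mult_1)
  note sqs = sq sq[THEN sq']
  have b2: "b2 > 0" unfolding b(1) using pos by (simp add: add_pos_pos)
  have ab: "b2 * b4 = a1 * a3" "a2 * b4 = a1 * b3" "b1 * b2 = a3 * a4" using b2 by (simp_all add: b(2-4))
  \<comment> \<open>The old equations are solved for the extra edges, so that everything becomes a
    combination of \<open>F3\<close> and \<open>F4\<close>.\<close>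
  have V3: "V3 = i4 * w43 * F4 / a4" unfolding F(1) using pos by (simp add: sqs mult_ac)
  have V4: "V4 = w3 * (i3 * F3 / a3 - w34 * F4)"
    unfolding F(2) using pos by (simp add: sqs algebra_simps add_divide_distrib)
  have w2V3: "w2 * V3 = - (i4 * g * w24) * F4 / a4" unfolding V3 using w(1) by (simp add: mult_ac)
  show "G1 = i1 * b1 * (w12 * G2)" unfolding G(3) by simp
  show 4: "G4 = i4 * b4 * (w4 * V4)" unfolding G(1) V4 w(2) by (simp add: sqs algebra_simps divide_inverse)
  have "G3 = (a2 * b4) * inverse a1 * i3 * - (g * w34) * (w4 * V4)" unfolding G(4) 4
    by (simp add: sqs algebra_simps)
  also have "\<dots> = i3 * b3 * (w3 * V4)" unfolding ab(2) w(2) using pos by (simp add: sqs algebra_simps)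
  finally show "G3 = i3 * b3 * (w3 * V4)" .
  have c1: "a1 = b2 * b4 / a3" using pos ab(1) by simp
  \<comment> \<open>Since \<open>b2 * b4 = a1 * a3\<close>, this is the definition of
    \<open>b2\<close> divided by \<open>a4\<close>; it produces the coefficient of \<open>F4\<close>
    in \<open>G2\<close>.\<close>
  have "b2 / a4 - b2 * b4 = a2 / a4" unfolding ab(1) unfolding b(1) using pos by (simp add: field_simps)
  note c = c1 this[symmetric]
  have "i2 * b2 * (w2 * V3 + w24 * G4) = - (i2 * i4 * g * w24) * (b2 / a4 - b2 * b4) * F4
      - (b2 * b4 / a3) * (i2 * i3 * i4 * g * w24 * w34) * F3"
    unfolding w2V3 G(1) by (simp add: algebra_simps divide_inverse)
  also have "\<dots> = G2" unfolding G(2) c[symmetric] i by (simp add: algebra_simps divide_inverse)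
  finally show 2: "G2 = i2 * b2 * (w2 * V3 + w24 * G4)" ..
  show "- g * w24 * w34 * p * w13 * G2 = p * (i1 * a1 * (w13 * F3)) +
    (- g * w24 * w34 * p * w13) * (i2 * a2 * (w2 * V3))"
    unfolding w2V3 G(2) by (simp add: sqs algebra_simps divide_inverse)
  have "- g * w24 * w34 * q * w12 * G1 + q * G3 =
    q * ((b1 * a1 + a2 * inverse a1 * (b4 * inverse a3)) * F3 +
      (b1 * a2 * inverse a4 - a2 * inverse a1 * b4) * w34 * i3 * F4)"
    unfolding G(3,4,2,1) i by (simp add: sqs algebra_simps)
  \<comment> \<open>The numerator over \<open>b2\<close> is \<open>a1 * a3 * a4 + a2\<close>, so
    \<open>F3\<close> gets coefficient 1; the two contributions to \<open>F4\<close> are both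
    \<open>a2 * a3 / b2\<close> and cancel.\<close>
  also have "b1 * a1 + a2 * inverse a1 * (b4 * inverse a3) = b2 / b2" unfolding b(2,4)
    using pos b2 by (simp add: field_simps) (simp add: b(1) algebra_simps)
  also have "b1 * a2 * inverse a4 - a2 * inverse a1 * b4 = 0" unfolding b(2,4) using pos
    by (simp add: field_simps)
  finally show "- g * w24 * w34 * q * w12 * G1 + q * G3 = q * F3" using b2 by simp
qed

section \<open>The edge system after the move\<close>

context square_network
begin

lemma square_move_simps [simp]:
  "edges (square_move N S P Q R) = edges N - {(S, P), (Q, R)} \<union> {(P, S), (R, Q)}"
  "bdry (square_move N S P Q R) = bdry N" "verts (square_move N S P Q R) = verts N"
  "internal (square_move N S P Q R) = internal N"
  "gauge_ray (square_move N S P Q R) = gauge_ray N"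
  by (simp_all add: square_move_def Let_def internal_def gauge_ray_def fun_eq_iff)

lemma square_move_out_edges:
  "v \<notin> {S, P, Q, R} \<Longrightarrow> out_edges (square_move N S P Q R) v = out_edges N v"
  "out_edges (square_move N S P Q R) S = {(S, R)}"
  "out_edges (square_move N S P Q R) P = {(P, S), (P, Q)}"
  "out_edges (square_move N S P Q R) Q = out_edges N Q - {(Q, R)}"
  "out_edges (square_move N S P Q R) R = insert (R, Q) (out_edges N R)"
proof -
  have out: "out_edges (square_move N S P Q R) v =
    {e \<in> out_edges N v. e \<noteq> (S, P) \<and> e \<noteq> (Q, R)} \<union> {e \<in> {(P, S), (R, Q)}. fst e = v}" for v
    by (auto simp: out_edges_def)
  have ne: "S \<noteq> P" "S \<noteq> Q" "S \<noteq> R" "P \<noteq> Q" "P \<noteq> R" "Q \<noteq> R" using square_distinct by auto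
  show "v \<notin> {S, P, Q, R} \<Longrightarrow> out_edges (square_move N S P Q R) v = out_edges N v"
    unfolding out by (auto simp: out_edges_def)
  show "out_edges (square_move N S P Q R) S = {(S, R)}"
    "out_edges (square_move N S P Q R) P = {(P, S), (P, Q)}"
    unfolding out square_vertex_edges using ne by auto
  show "out_edges (square_move N S P Q R) Q = out_edges N Q - {(Q, R)}"
    "out_edges (square_move N S P Q R) R = insert (R, Q) (out_edges N R)"
    unfolding out using ne by (auto simp: out_edges_def)
qed

text \<open>Only edges between internal vertices are reversed, so the sources and their gauge rays
  stay the same.\<close>

lemma square_move_int_num [simp]: "int_num (square_move N S P Q R) l e = int_num N l e"
proof -
  have "bdry N j \<notin> {S, P, Q, R}" for j using square_internal by (auto simp: internal_def)
  then have "is_source (square_move N S P Q R) j = is_source N j" for j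
    unfolding is_source_def by (simp add: square_move_out_edges(1))
  then show ?thesis by (simp add: int_num_def)
qed

text \<open>All edges entering \<open>Q\<close> or \<open>R\<close> belong to the square, so an edge
  outside it can meet a changed sum only at \<open>S\<close> or \<open>P\<close>.\<close>

lemma square_move_edge_cases:
  assumes "e \<in> edges (square_move N S P Q R)"
  obtains "e = (P, S)" | "e = (S, R)" | "e = (P, Q)" | "e = (R, Q)"
    | "e \<in> edges N" "e \<notin> square_edges" "e \<noteq> (P, S)" "e \<noteq> (R, Q)" "snd e \<noteq> Q" "snd e \<noteq> R"
proof -
  have "(P, S) \<notin> edges N" "(R, Q) \<notin> edges N"
    using swap_notin_edges[of "(S, P)"] swap_notin_edges[of "(Q, R)"] square_edges_subset
    by (auto simp: square_edges_def)
  moreover have "e = (P, Q)" if "e \<in> edges N" "snd e = Q"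
    using square_vertex_edges(1) that by (auto simp: in_edges_def)
  moreover have "e = (S, R) \<or> e = (Q, R)" if "e \<in> edges N" "snd e = R"
    using square_vertex_edges(2) that by (auto simp: in_edges_def)
  ultimately show ?thesis using that assms unfolding square_edges_def by auto
qed

text \<open>Any solution of the old system yields one of the new system; uniqueness enters only in
  the theorem.\<close>

lemma square_move_edge_system:
  fixes E E'' :: "edge \<Rightarrow> real ^ ('n::{finite,linorder})" and a1 a2 a3 a4 b1 b2 b3 b4 i1 i2 i3 i4 g w34 w24
    w12 :: real
  defines "a1 \<equiv> weight N (S, P)" and "a2 \<equiv> weight N (S, R)" and "a3 \<equiv> weight N (P, Q)" and
    "a4 \<equiv> weight N (Q, R)"
    and "b2 \<equiv> a2 + a1 * a3 * a4" and "b1 \<equiv> a3 * a4 / b2" and "b3 \<equiv> a2 * a3 / b2" and "b4 \<equiv> a1 * a3 / b2"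
    and "i1 \<equiv> (- 1) ^ int_num N l (S, P)" and "i2 \<equiv> (- 1) ^ int_num N l (S, R)"
    and "i3 \<equiv> (- 1) ^ int_num N l (P, Q)" and "i4 \<equiv> (- 1) ^ int_num N l (Q, R)"
    and "g \<equiv> gsign l (R - Q)" and "w34 \<equiv> wsign l (Q - P) (R - Q)" and "w24 \<equiv> wsign l (R - S) (Q - R)"
    and "w12 \<equiv> wsign l (S - P) (R - S)"
  assumes E: "edge_system N l E"
    and G: "G4 = (b4 * inverse a3 * - (i3 * i4 * g * w34)) *\<^sub>R E (P, Q) + (b4 * (i4 * g)) *\<^sub>R E (Q, R)"
      "G2 = (a1 * - (i1 * g * w24 * w34)) *\<^sub>R E (P, Q) +
        (a2 * inverse a4 * - (i2 * i4 * g * w24)) *\<^sub>R E (Q, R)"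
      "G1 = (b1 * (i1 * w12)) *\<^sub>R G2" "G3 = (- (i3 * i4 * g * w34) * a2 * inverse a1) *\<^sub>R G4"
    and E'': "E'' = E((P, S) := G1, (S, R) := G2, (P, Q) := G3, (R, Q) := G4)"
  shows "edge_system (square_move N S P Q R) l E''"
proof -
  let ?N' = "square_move N S P Q R"
  have ne: "S \<noteq> P" "S \<noteq> Q" "S \<noteq> R" "P \<noteq> Q" "P \<noteq> R" "Q \<noteq> R" using square_distinct by auto
  have h: "(S, P) \<in> edges N" "(P, Q) \<in> edges N" "(Q, R) \<in> edges N" "(S, R) \<in> edges N"
    using square_edges_subset by (auto simp: square_edges_def)
  have int: "S \<in> internal N" "P \<in> internal N" "Q \<in> internal N" "R \<in> internal N" using square_internal
    by auto
  have nb: "bdry N j \<noteq> S" "bdry N j \<noteq> P" "bdry N j \<noteq> Q" "bdry N j \<noteq> R" for j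
    using int by (auto simp: internal_def)
  have pos: "a1 > 0" "a2 > 0" "a3 > 0" "a4 > 0"
    using network(1) h unfolding plabic_network_def a1_def a2_def a3_def a4_def by blast+
  have W: "weight ?N' (P, S) = b1" "weight ?N' (S, R) = b2" "weight ?N' (P, Q) = b3"
    "weight ?N' (R, Q) = b4"
    "e \<notin> square_edges \<Longrightarrow> e \<noteq> (P, S) \<Longrightarrow> e \<noteq> (R, Q) \<Longrightarrow> weight ?N' e = weight N e" for e
    using ne by (simp_all add: square_move_def Let_def b1_def b2_def b3_def b4_def a1_def a2_def a3_def
      a4_def square_edges_def)
  obtain e4 where e4: "e4 \<notin> square_edges" "out_edges N Q = {(Q, R), e4}" using square_vertex_edges(5)
    by blast
  obtain e3 where e3: "e3 \<notin> square_edges" "out_edges N R = {e3}" using square_vertex_edges(6) by blast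
  have e4': "e4 \<in> edges N" "fst e4 = Q" using e4(2) out_edgesD by blast+
  have e3': "e3 \<in> edges N" "fst e3 = R" using e3(2) out_edgesD by blast+
  have ne34: "e4 \<noteq> (Q, R)" "e4 \<noteq> (R, Q)" "e3 \<noteq> (R, Q)" "e4 \<noteq> (P, S)" "e3 \<noteq> (P, S)"
    using e4(1) e3' e4' ne swap_notin_edges[of "(Q, R)"] h by (auto simp: square_edges_def)
  have E'': "E'' (P, S) = G1" "E'' (S, R) = G2" "E'' (P, Q) = G3" "E'' (R, Q) = G4"
    "e \<notin> square_edges \<Longrightarrow> e \<noteq> (P, S) \<Longrightarrow> e \<noteq> (R, Q) \<Longrightarrow> E'' e = E e" for e
    using ne unfolding E'' by (auto simp: square_edges_def)
  have gen: "cross (dir e) l \<noteq> 0" if "e \<in> edges ?N'" for e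
    using that generic square_generic_swap by (auto simp: dir_def)
  have sysN: "E e = (sg (int (int_num N l e)) * weight N e) *\<^sub>R (\<Sum>f\<in>out_edges N (snd e). wsign l (dir e) (dir f) *\<^sub>R E f)"
    if "e \<in> edges N" "snd e \<in> internal N" for e
  proof -
    have "sg (wind l e f) = wsign l (dir e) (dir f)" if "f \<in> out_edges N (snd e)" for f
      using that \<open>e \<in> edges N\<close> by (intro sg_wind generic) (auto simp: out_edges_def)
    then show ?thesis using E that unfolding edge_system_def by (simp cong: sum.cong)
  qed
  have d: "dir (S, P) = P - S" "dir (S, R) = R - S" "dir (P, Q) = Q - P" "dir (Q, R) = R - Q"
    "dir (P, S) = S - P"
    "dir (R, Q) = Q - R" by (simp_all add: dir_def)
  define w43 w3 w2 w13 w4 where w: "w43 = wsign l (R - Q) (dir e3)" "w3 = wsign l (Q - P) (dir e4)"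
    "w2 = wsign l (R - S) (dir e3)" "w13 = wsign l (P - S) (Q - P)" "w4 = wsign l (Q - R) (dir e4)"
  have F: "E (Q, R) = (i4 * a4) *\<^sub>R (w43 *\<^sub>R E e3)"
    "E (P, Q) = (i3 * a3) *\<^sub>R (w34 *\<^sub>R E (Q, R) + w3 *\<^sub>R E e4)"
    "E (S, R) = (i2 * a2) *\<^sub>R (w2 *\<^sub>R E e3)"
    "E (S, P) = (i1 * a1) *\<^sub>R (w13 *\<^sub>R E (P, Q))"
    using sysN[OF h(3)] sysN[OF h(2)] sysN[OF h(4)] sysN[OF h(1)] int ne34(1)
    unfolding w i1_def i2_def i3_def i4_def a1_def a2_def a3_def a4_def w34_def
    by (simp_all add: e3 e4 square_vertex_edges d sg_int)
  have "even (int_num N l (S, P) + int_num N l (P, Q) + int_num N l (Q, R) + int_num N l (S, R))"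
    using even_int_num_quad[OF network] h square_internal by blast
  then have i: "i1 = i2 * i3 * i4"
    unfolding i1_def i2_def i3_def i4_def power_add[symmetric] by (auto simp: minus_one_power_iff)
  have i_sq: "i1 * i1 = 1" "i2 * i2 = 1" "i3 * i3 = 1" "i4 * i4 = 1"
    unfolding i1_def i2_def i3_def i4_def by (simp_all flip: power_add)
  have w_rel: "w2 * w43 = - g * w24" "w4 = - g * w34 * w3"
    using wsign_R[OF e3'(1) e3(1) e3'(2)] wsign_Q[OF e4'(1) e4(1) e4'(2)]
    unfolding w g_def w24_def w34_def by simp_all
  have sq: "g * g = 1" "w34 * w34 = 1" "w3 * w3 = 1"
      "w43 * w43 = 1" "w24 * w24 = 1" "w2 * w2 = 1" "w12 * w12 = 1" "w13 * w13 = 1"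
    unfolding w g_def w24_def w34_def w12_def by simp_all
  have alg: "G1 = (i1 * b1) *\<^sub>R (w12 *\<^sub>R G2)"
    "G2 = (i2 * b2) *\<^sub>R (w2 *\<^sub>R E e3 + w24 *\<^sub>R G4)"
    "G3 = (i3 * b3) *\<^sub>R (w3 *\<^sub>R E e4)"
    "G4 = (i4 * b4) *\<^sub>R (w4 *\<^sub>R E e4)"
    "(- g * w24 * w34 * p * w13) *\<^sub>R G2 = p *\<^sub>R E (S, P) + (- g * w24 * w34 * p * w13) *\<^sub>R E (S, R)"
    "(- g * w24 * w34 * q * w12) *\<^sub>R G1 + q *\<^sub>R G3 = q *\<^sub>R E (P, Q)" for p q
  proof -
    \<comment> \<open>The algebra is over the reals, so the vector equations are read in each
      coordinate.\<close>
    have c: "E (Q, R) $ k = i4 * a4 * (w43 * E e3 $ k)"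
      "E (P, Q) $ k = i3 * a3 * (w34 * E (Q, R) $ k + w3 * E e4 $ k)"
      "G4 $ k = b4 * inverse a3 * - (i3 * i4 * g * w34) * E (P, Q) $ k + b4 * (i4 * g) * E (Q, R) $ k"
      "G2 $ k = a1 * - (i1 * g * w24 * w34) * E (P, Q) $ k +
        a2 * inverse a4 * - (i2 * i4 * g * w24) * E (Q, R) $ k"
      "G1 $ k = b1 * (i1 * w12) * G2 $ k" "G3 $ k = - (i3 * i4 * g * w34) * a2 * inverse a1 * G4 $ k" for k
      using F(1,2)[THEN arg_cong, of "\<lambda>v. v $ k"] G[THEN arg_cong, of "\<lambda>v. v $ k"]
      by (simp_all only: vector_scaleR_component vector_add_component real_scaleR_def)
    note r = square_move_algebra[OF pos b2_def[THEN meta_eq_to_obj_eq] b1_def[THEN meta_eq_to_obj_eq]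
        b3_def[THEN meta_eq_to_obj_eq] b4_def[THEN meta_eq_to_obj_eq] i_sq sq i w_rel c]
    show "G1 = (i1 * b1) *\<^sub>R (w12 *\<^sub>R G2)"
      "G2 = (i2 * b2) *\<^sub>R (w2 *\<^sub>R E e3 + w24 *\<^sub>R G4)"
      "G3 = (i3 * b3) *\<^sub>R (w3 *\<^sub>R E e4)"
      "G4 = (i4 * b4) *\<^sub>R (w4 *\<^sub>R E e4)"
      unfolding vec_eq_iff vector_scaleR_component vector_add_component real_scaleR_def using r(1-4)
        by blast+
    show "(- g * w24 * w34 * p * w13) *\<^sub>R G2 = p *\<^sub>R E (S, P) + (- g * w24 * w34 * p * w13) *\<^sub>R E (S, R)"
      unfolding F(3,4) vec_eq_iff vector_scaleR_component vector_add_component real_scaleR_def using r(5)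
        by blast
    show "(- g * w24 * w34 * q * w12) *\<^sub>R G1 + q *\<^sub>R G3 = q *\<^sub>R E (P, Q)"
      unfolding vec_eq_iff vector_scaleR_component vector_add_component real_scaleR_def using r(6) by blast
  qed
  have out: "out_edges ?N' S = {(S, R)}" "out_edges ?N' P = {(P, S), (P, Q)}" "out_edges ?N' Q = {e4}"
    "out_edges ?N' R = {(R, Q), e3}"
    using square_move_out_edges(2-5) e3 e4 ne34 by auto
  have E34: "E'' e3 = E e3" "E'' e4 = E e4" using E''(5) e3 e4 ne34 by auto
  have vs: "E'' e = (sg (int (int_num N l e)) * weight ?N' e) *\<^sub>R (\<Sum>f\<in>out_edges ?N' (snd e). wsign l (dir e) (dir f) *\<^sub>R E'' f)"
    if e: "e \<in> edges ?N'" and v: "snd e \<in> internal N" for e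
    using e
  proof (cases rule: square_move_edge_cases)
    case 1
    then show ?thesis using alg(1) int_num_swap[of N l "(S, P)"]
      by (simp add: out E'' W d sg_int i1_def w12_def)
  next
    case 2
    then show ?thesis using alg(2) ne34 by (simp add: out E'' E34 W d sg_int i2_def w w24_def add.commute)
  next
    case 3
    then show ?thesis using alg(3) by (simp add: out E'' E34 W d sg_int i3_def w)
  next
    case 4
    then show ?thesis using alg(4) int_num_swap[of N l "(Q, R)"]
      by (simp add: out E'' E34 W d sg_int i4_def w)
  next
    case 5
    \<comment> \<open>Vector and weight of \<open>e\<close> are unchanged, so only the sums at its
      end point have to be compared.\<close>
    have old: "E'' e = (sg (int (int_num N l e)) * weight ?N' e) *\<^sub>R (\<Sum>f\<in>out_edges N (snd e). wsign l (dir e) (dir f) *\<^sub>R E f)"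
      using 5 v sysN[of e] by (simp add: E''(5) W(5))
    consider "snd e = S" | "snd e = P" | "snd e \<notin> {S, P, Q, R}" using 5 by blast
    then show ?thesis
    proof cases
      case 1
      \<comment> \<open>The parameter is the winding of \<open>e\<close> into \<open>h1\<close>;
        \<open>wsign_S\<close> identifies the other coefficient as its winding into
        \<open>h2\<close>.\<close>
      show ?thesis unfolding old unfolding 1 out square_vertex_edges
        using alg(5)[of "wsign l (dir e) (P - S)"] wsign_S[OF 5(1,2) 1] ne
        by (simp add: d E'' g_def w24_def w34_def w)
    next
      case 2
      show ?thesis unfolding old unfolding 2 out square_vertex_edges
        using alg(6)[of "wsign l (dir e) (Q - P)"] wsign_P[OF 5(1,2) 2] ne
        by (simp add: d E'' g_def w24_def w34_def w12_def)
    next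
      case 3
      have "E'' f = E f" if "f \<in> out_edges N (snd e)" for f
        using that 3 by (intro E''(5)) (auto simp: out_edges_def square_edges_def)
      then show ?thesis unfolding old square_move_out_edges(1)[OF 3] by simp
    qed
  qed
  have "E'' e = (sg (int (int_num N l e)) * weight ?N' e) *\<^sub>R axis j 1"
    if e: "e \<in> edges ?N'" and j: "snd e = bdry N j" for e j
    using e
  proof (cases rule: square_move_edge_cases)
    case 5
    then have "E e = (sg (int (int_num N l e)) * weight N e) *\<^sub>R axis j 1"
      using E j unfolding edge_system_def by blast
    then show ?thesis using 5 by (simp add: E''(5) W(5))
  qed (use j nb in \<open>auto dest: sym\<close>)
  moreover have "sg (wind l e f) = wsign l (dir e) (dir f)" if "e \<in> edges ?N'"
    "f \<in> out_edges ?N' (snd e)" for e f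
    using that by (intro sg_wind gen) (auto simp: out_edges_def)
  ultimately show ?thesis unfolding edge_system_def using vs by (simp cong: sum.cong)
qed

end

theorem lemma5p1:
  fixes N N' :: "'n::{finite,linorder} network"
    and l S P Q R :: complex
    and E E' :: "edge \<Rightarrow> real ^ ('n::{finite,linorder})"
    and h1 h2 h3 h4 :: edge
    and \<alpha>1 \<alpha>2 \<alpha>3 \<alpha>4 \<beta>1 \<beta>2 \<beta>3 \<beta>4 :: real
    and F1 F2 F3 F4 G1 G2 G3 G4 :: "real ^ ('n::{finite,linorder})"
  assumes network: "plabic_network N" "gauge_direction N l"
    and square: "square_config N S P Q R"
    and move: "N' = square_move N S P Q R"
    and E: "edge_vectors N l E"
    and E': "edge_vectors N' l E'"
    and h: "h1 = (S, P)" "h2 = (S, R)" "h3 = (P, Q)" "h4 = (Q, R)"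
    and \<alpha>: "\<alpha>1 = weight N h1" "\<alpha>2 = weight N h2" "\<alpha>3 = weight N h3" "\<alpha>4 = weight N h4"
    and \<beta>: "\<beta>1 = weight N' (prod.swap h1)" "\<beta>2 = weight N' h2"
      "\<beta>3 = weight N' h3" "\<beta>4 = weight N' (prod.swap h4)"
    and F: "F1 = E h1" "F2 = E h2" "F3 = E h3" "F4 = E h4"
    and G: "G1 = E' (prod.swap h1)" "G2 = E' h2" "G3 = E' h3" "G4 = E' (prod.swap h4)"
  shows
    "G4 = (\<beta>4 * inverse \<alpha>3 * sg (int (int_num N l h3) + int (int_num N l h4) + gamma2 l h4
              + wind l h3 h4 + 1)) *\<^sub>R F3
        + (\<beta>4 * sg (int (int_num N l h4) + gamma2 l h4)) *\<^sub>R F4 \<and>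
     G2 = (\<alpha>1 * sg (int (int_num N l h1) + gamma2 l h4 + wind l h2 (prod.swap h4)
              + wind l h3 h4 + 1)) *\<^sub>R F3
        + (\<alpha>2 * inverse \<alpha>4 * sg (1 + int (int_num N l h2) + int (int_num N l h4) + gamma2 l h4
              + wind l h2 (prod.swap h4))) *\<^sub>R F4 \<and>
     G1 = (\<beta>1 * sg (int (int_num N l h1) + wind l (prod.swap h1) h2)) *\<^sub>R G2 \<and>
     G3 = (sg (int (int_num N l h3) + int (int_num N l h4) + gamma2 l h4 + wind l h3 h4 + 1)
              * \<alpha>2 * inverse \<alpha>1) *\<^sub>R G4"
proof -
  interpret square_network N l S P Q R
    using network square by unfold_locales
  have ne: "S \<noteq> P" "S \<noteq> Q" "S \<noteq> R" "P \<noteq> Q" "P \<noteq> R" "Q \<noteq> R" using square_distinct by auto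
  have h': "(S, P) \<in> edges N" "(S, R) \<in> edges N" "(P, Q) \<in> edges N" "(Q, R) \<in> edges N"
    using square_edges_subset by (auto simp: square_edges_def)
  have \<beta>': "\<beta>1 = \<alpha>3 * \<alpha>4 / (\<alpha>2 + \<alpha>1 * \<alpha>3 * \<alpha>4)" "\<beta>4 = \<alpha>1 * \<alpha>3 / (\<alpha>2 + \<alpha>1 * \<alpha>3 * \<alpha>4)"
    using ne unfolding \<beta> \<alpha> h move by (simp_all add: square_move_def Let_def)
  let ?i = "\<lambda>h. (- 1) ^ int_num N l h" and ?g = "gsign l (R - Q)" and ?w34 = "wsign l (Q - P) (R - Q)"
    and ?w24 = "wsign l (R - S) (Q - R)" and ?w12 = "wsign l (S - P) (R - S)"
  \<comment> \<open>The stated right-hand sides with each power of -1 split into real signs; the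
    summand 1 in an exponent becomes the minus sign.\<close>
  define H4 where "H4 = (\<beta>4 * inverse \<alpha>3 * - (?i h3 * ?i h4 * ?g * ?w34)) *\<^sub>R F3 +
    (\<beta>4 * (?i h4 * ?g)) *\<^sub>R F4"
  define H2 where "H2 = (\<alpha>1 * - (?i h1 * ?g * ?w24 * ?w34)) *\<^sub>R F3 +
    (\<alpha>2 * inverse \<alpha>4 * - (?i h2 * ?i h4 * ?g * ?w24)) *\<^sub>R F4"
  define H1 where "H1 = (\<beta>1 * (?i h1 * ?w12)) *\<^sub>R H2"
  define H3 where "H3 = (- (?i h3 * ?i h4 * ?g * ?w34) * \<alpha>2 * inverse \<alpha>1) *\<^sub>R H4"
  define E2 where "E2 = E((P, S) := H1, (S, R) := H2, (P, Q) := H3, (R, Q) := H4)"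
  have "edge_system N' l E2"
    unfolding move
    by (rule square_move_edge_system[OF _ H4_def[unfolded F \<alpha> \<beta>' h] H2_def[unfolded F \<alpha> h]
          H1_def[unfolded \<beta>' \<alpha> h] H3_def[unfolded \<alpha> h] E2_def])
      (use E in \<open>simp add: edge_vectors_def\<close>)
  then have "E' e = E2 e" if "e \<in> edges N'" for e
    using E' that unfolding edge_vectors_def by metis
  moreover have "{(P, S), (S, R), (P, Q), (R, Q)} \<subseteq> edges N'"
    unfolding move using h' ne by simp
  ultimately have GH: "G1 = H1" "G2 = H2" "G3 = H3" "G4 = H4"
    unfolding G h E2_def using ne by simp_all
  have sgs: "sg (gamma2 l h4) = ?g" "sg (wind l h3 h4) = ?w34" "sg (wind l h2 (prod.swap h4)) = ?w24"
    "sg (wind l (prod.swap h1) h2) = ?w12"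
    using square_generic square_generic_swap unfolding h
    by (simp_all add: sg_gamma2 sg_wind dir_def)
  show ?thesis
    unfolding GH sg_add sg_int sgs sg_1
    by (simp add: H1_def H2_def H3_def H4_def mult_ac)
qed

end
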